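(* Let $p$ be a prime, $S$ a finite $p$-group and $\mathcal{F}$ a fusion system over $S$ (not necessarily saturated). Let $(\mathcal{L},\Delta,S)$ be a locality over $\mathcal{F}$ of objective characteristic $p$. Then a subgroup $Q\leq S$ is normal in $\mathcal{F}$ if and only if $\mathcal{L}=N_{\mathcal{L}}(Q)$. Similarly, a subgroup $Q\leq S$ satisfies $Q\leq Z(\mathcal{F})$ if and only if $\mathcal{L}=C_{\mathcal{L}}(Q)$.
   Context: Fusion systems. For $P\leq S$, $N_{\mathcal{F}}(P)$ [resp. $C_{\mathcal{F}}(P)$] is the fusion system over $N_S(P)$ [resp. $C_S(P)$] whose morphisms $A\to B$ are those $\varphi\in\mathrm{Hom}_{\mathcal{F}}(A,B)$ which extend to some $\hat\varphi\in \mathrm{Hom}_{\mathcal{F}}(AP,BP)$ mapping $P$ onto $P$ [resp. with $\hat\varphi|_P=\mathrm{id}_P$]. $Q\leq S$ is normal in $\mathcal{F}$ if $Q\unlhd S$ and $N_{\mathcal{F}}(Q)=\mathcal{F}$. $Z(\mathcal{F})$ is the largest subgroup $Z$ of $S$ with $C_{\mathcal{F}}(Z)=\mathcal{F}$. A finite group $G$ is of characteristic $p$ if $C_G(O_p(G))\leq O_p(G)$. Partial groups. Let $\mathbf{W}(\mathcal{L})$ be the set of words in a set $\mathcal{L}$, $\circ$ concatenation, $\emptyset$ the empty word. A partial group is a non-empty set $\mathcal{L}$ with $\mathbf{D}\subseteq \mathbf{W}(\mathcal{L})$, a map $\Pi\colon\mathbf{D}\to\mathcal{L}$ and an involutory bijection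 $f\mapsto f^{-1}$ of $\mathcal L$ such that: all words of length one are in $\mathbf{D}$, and $u\circ v\in\mathbf{D}$ implies $u,v\in\mathbf{D}$; $\Pi((f))=f$; if $u\circ v\circ w\in\mathbf{D}$ then $u\circ(\Pi(v))\circ w\in\mathbf{D}$ and $\Pi(u\circ v\circ w)=\Pi(u\circ(\Pi(v))\circ w)$; if $w=(f_1,\dots,f_n)\in\mathbf{D}$ then, with $w^{-1}=(f_n^{-1},\dots,f_1^{-1})$, $w^{-1}\circ w\in\mathbf{D}$ and $\Pi(w^{-1}\circ w)=\mathbf{1}:=\Pi(\emptyset)$. For $g\in\mathcal{L}$, $\mathbf{D}(g)=\{x: (g^{-1},x,g)\in\mathbf{D}\}$ and $x^g=\Pi(g^{-1},x,g)$ for $x\in\mathbf{D}(g)$; for $X\subseteq\mathbf{D}(g)$, $X^g=\{x^g:x\in X\}$. $N_{\mathcal{L}}(X)=\{g: X\subseteq\mathbf{D}(g),\,X^g=X\}$, $C_{\mathcal{L}}(X)=\{g: X\subseteq\mathbf{D}(g),\,x^g=x\ \forall x\in X\}$. A partial subgroup is a subset closed under inversion and under $\Pi$ on $\mathbf{D}$-words; it is a subgroup if all its words lie in $\mathbf{D}$ (it is then a group), and a $p$-subgroup if moreover it is a finite $p$-group. Localities. $(\mathcal{L},\Delta,S)$ is a locality if $\mathcal{L}$ is a finite partial group, $S$ is a maximal $p$-subgroup of $\mathcal{L}$, $\Delta$ is a non-empty set of subgroups of $S$ closed under overgroups in $S$ and under $\mathcal{L}$-conjugation (if $P\in\Delta$,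 $g\in\mathcal L$, $P\subseteq\mathbf{D}(g)$ and $P^g\subseteq S$ then $P^g\in\Delta$), and $\mathbf{D}$ is the set of words $(f_1,\dots,f_n)$ for which there are $P_0,\dots,P_n\in\Delta$ with $P_{i-1}\subseteq\mathbf{D}(f_i)$ and $P_{i-1}^{f_i}=P_i$ for all $i$. Then $N_{\mathcal{L}}(P)$ is a finite group for $P\in\Delta$. $\mathcal{F}_S(\mathcal{L})$ is the fusion system over $S$ generated by conjugation maps by elements of $\mathcal{L}$ between subgroups of $S$; the locality is over $\mathcal{F}$ if $\mathcal{F}=\mathcal{F}_S(\mathcal{L})$. It is of objective characteristic $p$ if $N_{\mathcal{L}}(P)$ is of characteristic $p$ for all $P\in\Delta$. *)

theory Defs
  imports "HOL-Algebra.Group_Action" "HOL-Computational_Algebra.Primes"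
begin

definition finite_p_group :: "nat \<Rightarrow> ('a, 'b) monoid_scheme \<Rightarrow> bool" where
  "finite_p_group p G \<longleftrightarrow> group G \<and> finite (carrier G) \<and> (\<exists>n. order G = p ^ n)"

definition group_centralizer :: "('a, 'b) monoid_scheme \<Rightarrow> 'a set \<Rightarrow> 'a set" where
  "group_centralizer G X = {g \<in> carrier G. \<forall>x\<in>X. g \<otimes>\<^bsub>G\<^esub> x = x \<otimes>\<^bsub>G\<^esub> g}"

text \<open>The largest normal \<open>p\<close>-subgroup; it exists if \<open>G\<close> is finite.\<close>

definition p_core :: "nat \<Rightarrow> ('a, 'b) monoid_scheme \<Rightarrow> 'a set" where
  "p_core p G = (GREATEST N. N \<lhd> G \<and> finite_p_group p (G\<lparr>carrier := N\<rparr>))"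

definition of_characteristic :: "nat \<Rightarrow> ('a, 'b) monoid_scheme \<Rightarrow> bool" where
  "of_characteristic p G \<longleftrightarrow> group_centralizer G (p_core p G) \<subseteq> p_core p G"

text \<open>
  Morphisms \<open>A \<rightarrow> B\<close> are represented by functions that are \<open>undefined\<close> outside \<open>A\<close>, so that
  equality of morphisms, and hence of fusion systems, is equality in HOL.  The Hom-sets are
  empty unless both arguments are subgroups of the underlying group.
\<close>

record 'a fusion_system =
  fs_group :: "'a monoid"
  fs_hom :: "'a set \<Rightarrow> 'a set \<Rightarrow> ('a \<Rightarrow> 'a) set"

locale fusion_system = group S for S :: "'a monoid" (structure) and F :: "'a fusion_system" +
  assumes fs_group: "fs_group F = S"
    and fs_hom_subgroups: "\<phi> \<in> fs_hom F A B \<Longrightarrow> subgroup A S \<and> subgroup B S"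
    and fs_hom_mono: "\<phi> \<in> fs_hom F A B \<Longrightarrow>
      \<phi> \<in> extensional A \<and> \<phi> \<in> hom (S\<lparr>carrier := A\<rparr>) (S\<lparr>carrier := B\<rparr>) \<and> inj_on \<phi> A"
    and fs_hom_conj: "\<lbrakk>subgroup A S; subgroup B S; s \<in> carrier S;
      (\<lambda>x. inv s \<otimes> x \<otimes> s) ` A \<subseteq> B\<rbrakk> \<Longrightarrow> (\<lambda>x\<in>A. inv s \<otimes> x \<otimes> s) \<in> fs_hom F A B"
    and fs_hom_comp: "\<lbrakk>\<phi> \<in> fs_hom F A B; \<psi> \<in> fs_hom F B C\<rbrakk> \<Longrightarrow> compose A \<psi> \<phi> \<in> fs_hom F A C"
    and fs_hom_corestrict: "\<phi> \<in> fs_hom F A B \<Longrightarrow> \<phi> \<in> fs_hom F A (\<phi> ` A)"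
    and fs_hom_inverse: "\<phi> \<in> fs_hom F A B \<Longrightarrow> restrict (inv_into A \<phi>) (\<phi> ` A) \<in> fs_hom F (\<phi> ` A) A"

definition fs_normalizer :: "'a fusion_system \<Rightarrow> 'a set \<Rightarrow> 'a fusion_system" where
  "fs_normalizer F P = (let S = fs_group F; T = normalizer S P in
     \<lparr>fs_group = S\<lparr>carrier := T\<rparr>,
      fs_hom = (\<lambda>A B. {\<phi> \<in> fs_hom F A B. A \<subseteq> T \<and> B \<subseteq> T \<and>
        (\<exists>\<psi> \<in> fs_hom F (A <#>\<^bsub>S\<^esub> P) (B <#>\<^bsub>S\<^esub> P). (\<forall>x\<in>A. \<psi> x = \<phi> x) \<and> \<psi> ` P = P)})\<rparr>)"

definition fs_centralizer :: "'a fusion_system \<Rightarrow> 'a set \<Rightarrow> 'a fusion_system" where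
  "fs_centralizer F P = (let S = fs_group F; T = group_centralizer S P in
     \<lparr>fs_group = S\<lparr>carrier := T\<rparr>,
      fs_hom = (\<lambda>A B. {\<phi> \<in> fs_hom F A B. A \<subseteq> T \<and> B \<subseteq> T \<and>
        (\<exists>\<psi> \<in> fs_hom F (A <#>\<^bsub>S\<^esub> P) (B <#>\<^bsub>S\<^esub> P). (\<forall>x\<in>A. \<psi> x = \<phi> x) \<and> (\<forall>x\<in>P. \<psi> x = x))})\<rparr>)"

definition normal_in_fusion_system :: "'a set \<Rightarrow> 'a fusion_system \<Rightarrow> bool" where
  "normal_in_fusion_system Q F \<longleftrightarrow> Q \<lhd> fs_group F \<and> fs_normalizer F Q = F"

text \<open>
  If every morphism extends to one that is the identity on \<open>Y\<close>, and likewise for \<open>Z\<close>, then the same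
  holds for \<open>Y <#> Z\<close>; so the greatest element below exists if \<open>S\<close> is finite.
\<close>

definition fs_center :: "'a fusion_system \<Rightarrow> 'a set" where
  "fs_center F = (GREATEST Z. subgroup Z (fs_group F) \<and> fs_centralizer F Z = F)"

text \<open>
  The smallest fusion system over \<open>S\<close> containing the family \<open>X\<close> of morphisms.  It is meaningful
  if some fusion system over \<open>S\<close> contains \<open>X\<close>, i.e. if \<open>X\<close> consists of injective homomorphisms
  between subgroups of \<open>S\<close>.
\<close>

definition fs_generated ::
  "'a monoid \<Rightarrow> ('a set \<Rightarrow> 'a set \<Rightarrow> ('a \<Rightarrow> 'a) set) \<Rightarrow> 'a fusion_system" where
  "fs_generated S X =
     \<lparr>fs_group = S,
      fs_hom = (\<lambda>A B. \<Inter>{fs_hom E A B |E. fusion_system S E \<and> (\<forall>A' B'. X A' B' \<subseteq> fs_hom E A' B')})\<rparr>"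

record 'a partial_group = "'a partial_object" +
  pg_words :: "'a list set"
  pg_prod :: "'a list \<Rightarrow> 'a"
  pg_inv :: "'a \<Rightarrow> 'a"

locale partial_group = fixes L :: "'a partial_group"
  assumes nonempty: "carrier L \<noteq> {}"
    and words_subset: "pg_words L \<subseteq> lists (carrier L)"
    and prod_closed: "w \<in> pg_words L \<Longrightarrow> pg_prod L w \<in> carrier L"
    and inv_closed: "f \<in> carrier L \<Longrightarrow> pg_inv L f \<in> carrier L"
    and inv_inv: "f \<in> carrier L \<Longrightarrow> pg_inv L (pg_inv L f) = f"
    and singleton_word: "f \<in> carrier L \<Longrightarrow> [f] \<in> pg_words L"
    and append_word: "u @ v \<in> pg_words L \<Longrightarrow> u \<in> pg_words L \<and> v \<in> pg_words L"
    and prod_singleton: "f \<in> carrier L \<Longrightarrow> pg_prod L [f] = f"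
    and prod_assoc: "u @ v @ w \<in> pg_words L \<Longrightarrow>
      u @ [pg_prod L v] @ w \<in> pg_words L \<and>
      pg_prod L (u @ v @ w) = pg_prod L (u @ [pg_prod L v] @ w)"
    and inverse_word: "w \<in> pg_words L \<Longrightarrow>
      rev (map (pg_inv L) w) @ w \<in> pg_words L \<and>
      pg_prod L (rev (map (pg_inv L) w) @ w) = pg_prod L []"

definition pg_conj_dom :: "'a partial_group \<Rightarrow> 'a \<Rightarrow> 'a set" where
  "pg_conj_dom L g = {x \<in> carrier L. [pg_inv L g, x, g] \<in> pg_words L}"

definition pg_conj :: "'a partial_group \<Rightarrow> 'a \<Rightarrow> 'a \<Rightarrow> 'a" where
  "pg_conj L g x = pg_prod L [pg_inv L g, x, g]"

definition pg_normalizer :: "'a partial_group \<Rightarrow> 'a set \<Rightarrow> 'a set" where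
  "pg_normalizer L X = {g \<in> carrier L. X \<subseteq> pg_conj_dom L g \<and> pg_conj L g ` X = X}"

definition pg_centralizer :: "'a partial_group \<Rightarrow> 'a set \<Rightarrow> 'a set" where
  "pg_centralizer L X = {g \<in> carrier L. X \<subseteq> pg_conj_dom L g \<and> (\<forall>x\<in>X. pg_conj L g x = x)}"

definition partial_subgroup :: "'a partial_group \<Rightarrow> 'a set \<Rightarrow> bool" where
  "partial_subgroup L H \<longleftrightarrow> H \<subseteq> carrier L \<and> (\<forall>h\<in>H. pg_inv L h \<in> H) \<and>
     (\<forall>w \<in> pg_words L \<inter> lists H. pg_prod L w \<in> H)"

definition pg_subgroup :: "'a partial_group \<Rightarrow> 'a set \<Rightarrow> bool" where
  "pg_subgroup L H \<longleftrightarrow> partial_subgroup L H \<and> lists H \<subseteq> pg_words L"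

definition pg_induced_group :: "'a partial_group \<Rightarrow> 'a set \<Rightarrow> 'a monoid" where
  "pg_induced_group L H = \<lparr>carrier = H, monoid.mult = (\<lambda>x y. pg_prod L [x, y]), monoid.one = pg_prod L []\<rparr>"

definition pg_p_subgroup :: "nat \<Rightarrow> 'a partial_group \<Rightarrow> 'a set \<Rightarrow> bool" where
  "pg_p_subgroup p L H \<longleftrightarrow> pg_subgroup L H \<and> finite_p_group p (pg_induced_group L H)"

text \<open>
  The \<open>p\<close>-group \<open>S\<close> is a group in its own right; \<open>S_mult\<close> says that its group structure is the one
  inherited from \<open>L\<close>.
\<close>

locale locality = partial_group L
  for p :: nat and L :: "'a partial_group" and \<Delta> :: "'a set set" and S :: "'a monoid" +
  assumes finite_carrier: "finite (carrier L)"
    and S_p_subgroup: "pg_p_subgroup p L (carrier S)"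
    and S_maximal: "\<lbrakk>pg_p_subgroup p L H; carrier S \<subseteq> H\<rbrakk> \<Longrightarrow> H = carrier S"
    and S_mult: "\<lbrakk>x \<in> carrier S; y \<in> carrier S\<rbrakk> \<Longrightarrow> x \<otimes>\<^bsub>S\<^esub> y = pg_prod L [x, y]"
    and objects_nonempty: "\<Delta> \<noteq> {}"
    and objects_subgroups: "P \<in> \<Delta> \<Longrightarrow> subgroup P S"
    and objects_overgroup: "\<lbrakk>P \<in> \<Delta>; subgroup R S; P \<subseteq> R\<rbrakk> \<Longrightarrow> R \<in> \<Delta>"
    and objects_conj: "\<lbrakk>P \<in> \<Delta>; g \<in> carrier L; P \<subseteq> pg_conj_dom L g; pg_conj L g ` P \<subseteq> carrier S\<rbrakk> \<Longrightarrow>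
      pg_conj L g ` P \<in> \<Delta>"
    and words_iff: "w \<in> pg_words L \<longleftrightarrow> w \<in> lists (carrier L) \<and>
      (\<exists>P :: nat \<Rightarrow> 'a set. (\<forall>i \<le> length w. P i \<in> \<Delta>) \<and>
        (\<forall>i < length w. P i \<subseteq> pg_conj_dom L (w ! i) \<and> pg_conj L (w ! i) ` P i = P (Suc i)))"

definition objective_characteristic :: "nat \<Rightarrow> 'a partial_group \<Rightarrow> 'a set set \<Rightarrow> bool" where
  "objective_characteristic p L \<Delta> \<longleftrightarrow>
     (\<forall>P\<in>\<Delta>. of_characteristic p (pg_induced_group L (pg_normalizer L P)))"

definition locality_fusion_system :: "'a partial_group \<Rightarrow> 'a monoid \<Rightarrow> 'a fusion_system" where
  "locality_fusion_system L S = fs_generated S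
     (\<lambda>A B. {restrict (pg_conj L g) A |g. subgroup A S \<and> subgroup B S \<and> g \<in> carrier L \<and>
        A \<subseteq> pg_conj_dom L g \<and> pg_conj L g ` A \<subseteq> B})"

definition locality_over ::
  "'a fusion_system \<Rightarrow> nat \<Rightarrow> 'a partial_group \<Rightarrow> 'a set set \<Rightarrow> 'a monoid \<Rightarrow> bool" where
  "locality_over F p L \<Delta> S \<longleftrightarrow> locality p L \<Delta> S \<and> F = locality_fusion_system L S"

end

theory Submission
  imports Defs "HOL-Algebra.Sylow" "HOL-Algebra.Zassenhaus"
begin

text \<open>
  Write \<open>x\<^sup>g\<close> for conjugation and let \<open>F\<close> be the fusion system of the locality. Only the forward
  implications have content; suppose that \<open>Q\<close> is normal in \<open>F\<close> and let \<open>M\<close> be the set of all \<open>g\<close>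
  normalizing \<open>Q\<close>. For an object \<open>P\<close> and \<open>g\<close> with \<open>P\<^sup>g \<subseteq> S\<close>, the morphism \<open>c\<^sub>g\<close> on \<open>P\<close> extends to a
  morphism on \<open>PQ\<close> that preserves \<open>Q\<close>. Every morphism of \<open>F\<close> is a composite of conjugations, and since
  \<open>PQ\<close> is an object, the conjugating elements form a word that can be multiplied; hence the extension
  is conjugation by one element \<open>f \<in> M\<close>. So every conjugation map defined on an object is also realized
  by an element of \<open>M\<close>. For central \<open>Q\<close> the same holds with the centralizer of \<open>Q\<close> as \<open>M\<close>. It remains
  to see that a partial subgroup \<open>M\<close> which contains \<open>S\<close> and realizes all these maps is everything
  (\<open>partial_subgroup_realizing_fusion_is_everything\<close>).

  This goes by induction on objects \<open>P\<close>, from large to small: all \<open>g\<close> with \<open>P\<^sup>g \<subseteq> S\<close> lie in \<open>M\<close>. Choosing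
  \<open>f \<in> M\<close> that induces the same map as \<open>g\<close> on \<open>P\<close>, the element \<open>c = g f\<^sup>-\<^sup>1\<close> centralizes \<open>P\<close>, and it is
  enough that \<open>c \<in> M\<close>. Let \<open>V\<close> be the largest normal \<open>p\<close>-subgroup of \<open>N(P)\<close>, so \<open>P \<subseteq> V\<close>. If \<open>V = P\<close>, then
  characteristic \<open>p\<close> gives \<open>c \<in> C(V) \<subseteq> V = P \<subseteq> S \<subseteq> M\<close>. If \<open>V\<close> is larger, conjugate a Sylow
  \<open>p\<close>-subgroup of \<open>N(P)\<close> that contains \<open>N\<^sub>S(P)\<close> into \<open>S\<close> by some \<open>h\<close>
  (\<open>p_subgroup_of_normalizer_conj_into_S\<close>). As \<open>h\<close> carries \<open>N\<^sub>S(P) > P\<close> into \<open>S\<close>, it lies in \<open>M\<close> by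
  induction; as \<open>c\<^sup>h\<close> normalizes the object \<open>V\<^sup>h\<close>, which is larger than \<open>P\<close>, it lies in \<open>M\<close> by induction
  too; hence so does \<open>c\<close>.

  The technical device throughout is the set of all elements of \<open>S\<close> that stay in \<open>S\<close> while they are
  conjugated by the successive letters of a word. A word can be multiplied if and only if this set
  contains an object, the set is then an object itself, and conjugation by the product is the
  composite of the conjugations by the letters (\<open>word_iff_object\<close>, \<open>source_in_objects\<close>,
  \<open>source_prod\<close>).
\<close>

section \<open>Actions of p-groups and Sylow subgroups\<close>

text \<open>
  An orbit with more than one element contains no fixed point, and its size is a nontrivial divisor of
  the order of the acting \<open>p\<close>-group.
\<close>

lemma (in group_action) prime_dvd_card_moved_points:
  assumes p: "prime (p::nat)" and order: "order G = p ^ n" and E: "finite E"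
  shows "p dvd card {x \<in> E. \<exists>g \<in> carrier G. \<phi> g x \<noteq> x}" (is "p dvd card ?M")
proof -
  \<comment> \<open>Summing the indicator of the moved points over each orbit separately gives a multiple of \<open>p\<close> every time.\<close>
  let ?f = "\<lambda>x. if x \<in> ?M then 1 else 0 :: nat"
  have "p dvd (\<Sum>x\<in>orb. ?f x)" if "orb \<in> orbits G E \<phi>" for orb
  proof -
    obtain x where x: "x \<in> E" "orb = orbit G \<phi> x"
      using \<open>orb \<in> orbits G E \<phi>\<close> unfolding orbits_def by blast
    have sub: "orb \<subseteq> E"
      using orbits_coverture that by blast
    show ?thesis
    proof (cases "orb \<subseteq> ?M")
      case True
      have "card orb dvd p ^ n"
        using orbit_stabilizer_theorem[OF x(1)] x(2) order by (metis dvd_triv_left)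
      then obtain k where k: "card orb = p ^ k"
        using p by (auto simp: divides_primepow_nat)
      have "x \<in> orb"
        using orbit_refl x by simp
      then obtain g where g: "g \<in> carrier G" "\<phi> g x \<noteq> x"
        using True by blast
      have "\<phi> g x \<in> orb"
        using g x by (auto simp: orbit_def)
      then have "\<not> is_singleton orb"
        using g(2) \<open>x \<in> orb\<close> by (metis is_singletonE singletonD)
      then have "card orb \<noteq> 1"
        by (simp add: is_singleton_altdef)
      then have "p dvd card orb"
        using k by (cases k) auto
      moreover have "(\<Sum>x\<in>orb. ?f x) = card orb"
        using sum.cong[OF refl, of orb ?f "\<lambda>_. 1"] True by (simp add: subset_iff)
      ultimately show ?thesis by simp
    next
      case False
      then obtain y where y: "y \<in> orb" "\<forall>g\<in>carrier G. \<phi> g y = y"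
        using sub by blast
      then have "y \<in> E" using sub by blast
      have "orb = orbit G \<phi> y"
        using disjoint_union[OF that, of "orbit G \<phi> y"] y(1) orbit_refl[OF \<open>y \<in> E\<close>] \<open>y \<in> E\<close>
        by (auto simp: orbits_def)
      then have "orb = {y}"
        using y(2) orbit_refl[OF \<open>y \<in> E\<close>] unfolding orbit_def by auto
      then show ?thesis using y(2) by simp
    qed
  qed
  then have "p dvd (\<Sum>orb\<in>orbits G E \<phi>. \<Sum>x\<in>orb. ?f x)"
    by (rule dvd_sum)
  also have "\<dots> = (\<Sum>x\<in>E. ?f x)"
    by (rule disjoint_sum[OF E])
  also have "\<dots> = (\<Sum>x\<in>?M. 1)"
    using E by (intro sum.mono_neutral_cong_right) auto
  also have "\<dots> = card ?M"
    by simp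
  finally show ?thesis .
qed

text \<open>
  Right multiplication by \<open>inv g\<close> rather than \<open>g\<close> makes this a left action.
\<close>

lemma (in group) coset_action:
  assumes K: "subgroup K G"
  shows "group_action G (rcosets K) (\<lambda>g. \<lambda>C\<in>rcosets K. C #> inv g)"
proof -
  have sub: "C \<subseteq> carrier G" if "C \<in> rcosets K" for C
    using that rcosets_part_G[OF K] by blast
  have closed: "C #> g \<in> rcosets K" if C: "C \<in> rcosets K" and g: "g \<in> carrier G" for C g
  proof -
    obtain a where "a \<in> carrier G" "C = K #> a"
      using C by (auto simp: RCOSETS_def)
    then have "C #> g = K #> (a \<otimes> g)"
      using coset_mult_assoc[OF subgroup.subset[OF K]] g by simp
    then show ?thesis
      using \<open>a \<in> carrier G\<close> g by (auto simp: RCOSETS_def)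
  qed
  have bij: "(\<lambda>C\<in>rcosets K. C #> inv g) \<in> Bij (rcosets K)" if g: "g \<in> carrier G" for g
  proof -
    have "bij_betw (\<lambda>C\<in>rcosets K. C #> inv g) (rcosets K) (rcosets K)"
      by (rule bij_betwI[where g = "\<lambda>C. C #> g"])
        (use g closed sub in \<open>auto simp: coset_mult_assoc\<close>)
    then show ?thesis by (simp add: Bij_def)
  qed
  have "(\<lambda>g. \<lambda>C\<in>rcosets K. C #> inv g) \<in> hom G (BijGroup (rcosets K))"
  proof (rule homI)
    fix g h assume gh: "g \<in> carrier G" "h \<in> carrier G"
    then show "(\<lambda>C\<in>rcosets K. C #> inv (g \<otimes> h)) =
        (\<lambda>C\<in>rcosets K. C #> inv g) \<otimes>\<^bsub>BijGroup (rcosets K)\<^esub> (\<lambda>C\<in>rcosets K. C #> inv h)"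
      using bij[OF gh(1)] bij[OF gh(2)] closed sub
      by (auto simp: BijGroup_def compose_def coset_mult_assoc inv_mult_group intro!: restrict_ext)
  qed (use bij in \<open>auto simp: BijGroup_def\<close>)
  then show ?thesis
    by (simp add: group_action_def group_hom_def group_hom_axioms_def group_BijGroup group_axioms)
qed

lemma (in group) prime_dvd_card_moved_cosets:
  assumes p: "prime p" and fin: "finite (carrier G)" and H: "subgroup H G" and cH: "card H = p ^ n"
    and K: "subgroup K G"
  shows "p dvd card {C \<in> rcosets K. \<exists>h\<in>H. C #> h \<noteq> C}"
proof -
  interpret HA: group_action "G\<lparr>carrier := H\<rparr>" "rcosets K" "\<lambda>g. \<lambda>C\<in>rcosets K. C #> inv g"
    using group_action.induced_action[OF coset_action[OF K] H] .
  have fin': "finite (rcosets K)"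
    using rcosets_part_G[OF K] fin by (metis finite_UnionD)
  have "p dvd card {x \<in> rcosets K. \<exists>g\<in>carrier (G\<lparr>carrier := H\<rparr>). (\<lambda>C\<in>rcosets K. C #> inv g) x \<noteq> x}"
    by (rule HA.prime_dvd_card_moved_points[OF p _ fin', where n = n]) (simp add: cH order_def)
  also have "{x \<in> rcosets K. \<exists>g\<in>carrier (G\<lparr>carrier := H\<rparr>). (\<lambda>C\<in>rcosets K. C #> inv g) x \<noteq> x} =
      {C \<in> rcosets K. \<exists>h\<in>(\<lambda>g. inv g) ` H. C #> h \<noteq> C}"
    by auto
  also have "(\<lambda>g. inv g) ` H = H"
  proof -
    have "h \<in> (\<lambda>g. inv g) ` H" if "h \<in> H" for h
      using imageI[OF subgroup.m_inv_closed[OF H that], of "\<lambda>g. inv g"] subgroup.mem_carrier[OF H that]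
      by simp
    then show ?thesis
      using subgroup.m_inv_closed[OF H] by auto
  qed
  finally show ?thesis .
qed

lemma (in group) coset_fixed_conj:
  assumes K: "subgroup K G" and x: "x \<in> carrier G" and h: "h \<in> carrier G"
    and fix_h: "(K #> x) #> h = K #> x"
  shows "x \<otimes> h \<otimes> inv x \<in> K"
proof -
  have "K #> (x \<otimes> h) = K #> x"
    using fix_h coset_mult_assoc[OF subgroup.subset[OF K] x h] by simp
  then have "K #> (x \<otimes> h \<otimes> inv x) = K"
    using coset_mult_inv2 x h subgroup.subset[OF K] by simp
  then show ?thesis
    using coset_join1 K x h by simp
qed

text \<open>
  By the count of moved cosets, \<open>H\<close> fixes some coset of \<open>K\<close> when it acts on all of them by
  right multiplication, because their number is prime to \<open>p\<close>.
\<close>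

lemma (in group) p_subgroup_conj_into_sylow:
  assumes p: "prime p" and fin: "finite (carrier G)" and H: "subgroup H G" "card H = p ^ n"
    and K: "subgroup K G" and index: "\<not> p dvd card (rcosets K)"
  shows "\<exists>x\<in>carrier G. (\<lambda>h. inv x \<otimes> h \<otimes> x) ` H \<subseteq> K"
proof -
  let ?M = "{C \<in> rcosets K. \<exists>h\<in>H. C #> h \<noteq> C}"
  have "?M \<noteq> rcosets K"
    using prime_dvd_card_moved_cosets[OF p fin H K] index by metis
  then obtain C where C: "C \<in> rcosets K" "\<forall>h\<in>H. C #> h = C" by blast
  then obtain x where x: "x \<in> carrier G" "C = K #> x" by (auto simp: RCOSETS_def)
  have "x \<otimes> h \<otimes> inv x \<in> K" if "h \<in> H" for h
    using coset_fixed_conj[OF K x(1)] C x that subgroup.subset[OF H(1)] by blast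
  then show ?thesis
    using x(1) by (intro bexI[of _ "inv x"]) auto
qed

text \<open>
  Let \<open>K\<close> act on its own cosets in \<open>H\<close>. Their number is divisible by \<open>p\<close>, and so is the number of moved
  ones; the coset \<open>K\<close> itself is fixed, so there is another fixed coset \<open>K x\<close>, and \<open>x\<close> normalizes \<open>K\<close>.
\<close>

lemma (in group) p_subgroup_normalizer_grows:
  assumes p: "prime p" and fin: "finite (carrier G)" and H: "subgroup H G" "card H = p ^ n"
    and K: "subgroup K G" "K \<subset> H"
  shows "\<exists>x\<in>H - K. \<forall>k\<in>K. x \<otimes> k \<otimes> inv x \<in> K"
proof -
  interpret GH: group "G\<lparr>carrier := H\<rparr>"
    using subgroup_imp_group H(1) .
  have KH: "subgroup K (G\<lparr>carrier := H\<rparr>)"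
    using subgroup_incl[OF K(1) H(1)] K(2) by blast
  have finH: "finite H"
    using fin subgroup.subset[OF H(1)] finite_subset by blast
  have lag: "card (rcosets\<^bsub>G\<lparr>carrier := H\<rparr>\<^esub> K) * card K = p ^ n"
    using GH.lagrange[OF KH] H(2) by (simp add: order_def)
  then obtain m where m: "card K = p ^ m"
    using p by (metis divides_primepow_nat dvd_triv_right)
  have "card K < card H"
    using K(2) finH by (rule psubset_card_mono[rotated])
  then have "card (rcosets\<^bsub>G\<lparr>carrier := H\<rparr>\<^esub> K) \<noteq> 1"
    using lag H(2) by auto
  moreover obtain k where "card (rcosets\<^bsub>G\<lparr>carrier := H\<rparr>\<^esub> K) = p ^ k"
    using lag p by (metis divides_primepow_nat dvd_triv_left)
  ultimately have dvd: "p dvd card (rcosets\<^bsub>G\<lparr>carrier := H\<rparr>\<^esub> K)"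
    by (cases k) auto
  let ?M = "{C \<in> rcosets\<^bsub>G\<lparr>carrier := H\<rparr>\<^esub> K. \<exists>h\<in>K. C #>\<^bsub>G\<lparr>carrier := H\<rparr>\<^esub> h \<noteq> C}"
  have dvdM: "p dvd card ?M"
    using GH.prime_dvd_card_moved_cosets[OF p _ KH m KH] finH by simp
  have finR: "finite (rcosets\<^bsub>G\<lparr>carrier := H\<rparr>\<^esub> K)"
    using dvd lag p by (metis card.infinite mult_0 power_eq_0_iff not_prime_0)
  have KR: "K \<in> rcosets\<^bsub>G\<lparr>carrier := H\<rparr>\<^esub> K - ?M"
    using subgroup.subgroup_in_rcosets[OF KH GH.group_axioms] coset_join2[OF _ K(1)] subgroup.subset[OF K(1)] by auto
  have "card (rcosets\<^bsub>G\<lparr>carrier := H\<rparr>\<^esub> K - ?M) = card (rcosets\<^bsub>G\<lparr>carrier := H\<rparr>\<^esub> K) - card ?M"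
    by (rule card_Diff_subset) (use finR in auto)
  then have "p dvd card (rcosets\<^bsub>G\<lparr>carrier := H\<rparr>\<^esub> K - ?M)"
    using dvd dvdM by simp
  then have "card (rcosets\<^bsub>G\<lparr>carrier := H\<rparr>\<^esub> K - ?M) \<noteq> 1"
    using p by (metis not_prime_1 One_nat_def nat_dvd_1_iff_1)
  then have "rcosets\<^bsub>G\<lparr>carrier := H\<rparr>\<^esub> K - ?M \<noteq> {K}" by auto
  then obtain C where C: "C \<in> rcosets\<^bsub>G\<lparr>carrier := H\<rparr>\<^esub> K - ?M" "C \<noteq> K"
    using KR by blast
  then obtain x where x: "x \<in> H" "C = K #> x"
    by (auto simp: RCOSETS_def)
  have xG: "x \<in> carrier G" using x(1) subgroup.subset[OF H(1)] by blast
  have "x \<notin> K"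
    using C(2) x(2) coset_join2[OF xG K(1)] by auto
  moreover have "x \<otimes> k \<otimes> inv x \<in> K" if "k \<in> K" for k
    using coset_fixed_conj[OF K(1) xG, of k] C x that subgroup.subset[OF K(1)] by auto
  ultimately show ?thesis using x(1) by blast
qed

lemma (in group) conj_cancel:
  assumes "x \<in> carrier G" "h \<in> carrier G"
  shows "x \<otimes> (inv x \<otimes> h \<otimes> x) \<otimes> inv x = h" "inv x \<otimes> (x \<otimes> h \<otimes> inv x) \<otimes> x = h"
proof -
  have "x \<otimes> (inv x \<otimes> h \<otimes> x) \<otimes> inv x = (x \<otimes> inv x) \<otimes> h \<otimes> (x \<otimes> inv x)"
    using assms by (simp only: m_assoc m_closed inv_closed)
  then show "x \<otimes> (inv x \<otimes> h \<otimes> x) \<otimes> inv x = h"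
    using assms by simp
  have "inv x \<otimes> (x \<otimes> h \<otimes> inv x) \<otimes> x = (inv x \<otimes> x) \<otimes> h \<otimes> (inv x \<otimes> x)"
    using assms by (simp only: m_assoc m_closed inv_closed)
  then show "inv x \<otimes> (x \<otimes> h \<otimes> inv x) \<otimes> x = h"
    using assms by simp
qed

lemma (in group) conj_subgroup:
  assumes "subgroup H G" "x \<in> carrier G"
  shows "subgroup ((\<lambda>h. inv x \<otimes> h \<otimes> x) ` H) G" "card ((\<lambda>h. inv x \<otimes> h \<otimes> x) ` H) = card H"
proof -
  have "inv x <# H #> x = (\<lambda>h. inv x \<otimes> h \<otimes> x) ` H"
    by (auto simp: l_coset_def r_coset_def)
  then show "subgroup ((\<lambda>h. inv x \<otimes> h \<otimes> x) ` H) G"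
    using subgroup_conjugation_is_surj1[OF assms(2,1)] by simp
  have "inj_on (\<lambda>h. inv x \<otimes> h \<otimes> x) H"
    using assms subgroup.mem_carrier[OF assms(1)] by (auto intro!: inj_onI)
  then show "card ((\<lambda>h. inv x \<otimes> h \<otimes> x) ` H) = card H"
    by (rule card_image)
qed

definition sylow_subgroup :: "nat \<Rightarrow> ('a, 'b) monoid_scheme \<Rightarrow> 'a set \<Rightarrow> bool" where
  "sylow_subgroup p G K \<longleftrightarrow> subgroup K G \<and> (\<exists>n. card K = p ^ n) \<and> \<not> p dvd card (rcosets\<^bsub>G\<^esub> K)"

lemma (in group) exists_sylow_subgroup:
  assumes p: "prime p" and fin: "finite (carrier G)"
  shows "\<exists>K. sylow_subgroup p G K"
proof -
  have pos: "order G > 0" using fin by (simp add: order_gt_0_iff_finite)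
  obtain m where m: "order G = p ^ multiplicity p (order G) * m" "\<not> p dvd m"
    using pos p by (metis multiplicity_decompose' not_prime_unit neq0_conv)
  obtain K where K: "subgroup K G" "card K = p ^ multiplicity p (order G)"
    using sylow_thm[OF p group_axioms m(1) fin] by blast
  have "card (rcosets K) = m"
    using lagrange[OF K(1)] m(1) K(2) pos by (metis mult.commute mult_cancel_left mult_eq_0_iff neq0_conv)
  then show ?thesis
    using K m(2) by (auto simp: sylow_subgroup_def)
qed

lemma (in group) sylow_subgroup_conj:
  assumes K: "sylow_subgroup p G K" and fin: "finite (carrier G)" and x: "x \<in> carrier G"
  shows "sylow_subgroup p G ((\<lambda>h. inv x \<otimes> h \<otimes> x) ` K)"
proof -
  have sub: "subgroup K G" using K by (simp add: sylow_subgroup_def)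
  have "card K > 0"
    using sub fin by (simp add: subgroup.finite_imp_card_positive)
  then have "card (rcosets ((\<lambda>h. inv x \<otimes> h \<otimes> x) ` K)) = card (rcosets K)"
    using lagrange[OF sub] lagrange[OF conj_subgroup(1)[OF sub x]] conj_subgroup(2)[OF sub x]
    by (metis mult_right_cancel neq0_conv)
  then show ?thesis
    using K conj_subgroup[OF sub x] by (simp add: sylow_subgroup_def)
qed

lemma (in group) p_subgroup_in_sylow:
  assumes p: "prime p" and fin: "finite (carrier G)" and H: "subgroup H G" "card H = p ^ n"
  shows "\<exists>K. sylow_subgroup p G K \<and> H \<subseteq> K"
proof -
  obtain K where K: "sylow_subgroup p G K"
    using exists_sylow_subgroup[OF p fin] by blast
  then obtain x where x: "x \<in> carrier G" "(\<lambda>h. inv x \<otimes> h \<otimes> x) ` H \<subseteq> K"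
    using p_subgroup_conj_into_sylow[OF p fin H] by (auto simp: sylow_subgroup_def)
  have "H \<subseteq> (\<lambda>h. inv (inv x) \<otimes> h \<otimes> inv x) ` K"
  proof
    fix h assume h: "h \<in> H"
    then have "h = inv (inv x) \<otimes> (inv x \<otimes> h \<otimes> x) \<otimes> inv x"
      using conj_cancel(1)[OF x(1), of h] x(1) subgroup.mem_carrier[OF H(1)] by simp
    then show "h \<in> (\<lambda>h. inv (inv x) \<otimes> h \<otimes> inv x) ` K"
      using x(2) h by blast
  qed
  then show ?thesis
    using sylow_subgroup_conj[OF K fin, of "inv x"] x(1) by blast
qed

lemma (in group) normal_p_subgroup_in_sylow:
  assumes p: "prime p" and fin: "finite (carrier G)" and N: "N \<lhd> G" "card N = p ^ n"
    and K: "sylow_subgroup p G K"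
  shows "N \<subseteq> K"
proof
  fix y assume y: "y \<in> N"
  have sub: "subgroup N G" using N(1) by (simp add: normal_imp_subgroup)
  obtain x where x: "x \<in> carrier G" "(\<lambda>h. inv x \<otimes> h \<otimes> x) ` N \<subseteq> K"
    using p_subgroup_conj_into_sylow[OF p fin sub N(2)] K by (auto simp: sylow_subgroup_def)
  have yG: "y \<in> carrier G" using y subgroup.mem_carrier[OF sub] by blast
  have "x \<otimes> y \<otimes> inv x \<in> N"
    using normal.inv_op_closed2[OF N(1) x(1) y] .
  moreover have "inv x \<otimes> (x \<otimes> y \<otimes> inv x) \<otimes> x = y"
    using conj_cancel(2)[OF x(1) yG] .
  ultimately show "y \<in> K" using x(2) by (metis image_subset_iff)
qed

text \<open>
  The intersection of all Sylow \<open>p\<close>-subgroups is normal because conjugation permutes them, and it contains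
  every normal \<open>p\<close>-subgroup \<open>N\<close>: a conjugate of \<open>N\<close>, hence \<open>N\<close> itself, lies in each of them. This
  shows that the greatest element in the definition of \<open>p_core\<close> exists.
\<close>

lemma (in group) p_core_is_largest:
  assumes p: "prime p" and fin: "finite (carrier G)"
  shows "p_core p G \<lhd> G \<and> (\<exists>n. card (p_core p G) = p ^ n) \<and>
    (\<forall>N n. N \<lhd> G \<longrightarrow> card N = p ^ n \<longrightarrow> N \<subseteq> p_core p G)"
proof -
  let ?P = "\<lambda>N. N \<lhd> G \<and> finite_p_group p (G\<lparr>carrier := N\<rparr>)"
  have P_iff: "?P N \<longleftrightarrow> N \<lhd> G \<and> (\<exists>n. card N = p ^ n)" for N
    using fin finite_subset[OF subgroup.subset[OF normal_imp_subgroup] fin]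
    by (auto simp: finite_p_group_def order_def intro: subgroup_imp_group[OF normal_imp_subgroup])
  let ?C = "\<Inter>{K. sylow_subgroup p G K}"
  obtain K n where K: "sylow_subgroup p G K" "card K = p ^ n"
    using exists_sylow_subgroup[OF p fin] by (auto simp: sylow_subgroup_def)
  have sub: "subgroup ?C G"
    using K by (intro subgroups_Inter) (auto simp: sylow_subgroup_def)
  have norm: "?C \<lhd> G"
    unfolding normal_inv_iff
  proof (intro conjI sub ballI InterI)
    fix x h K' assume x: "x \<in> carrier G" and h: "h \<in> ?C" and "K' \<in> {K. sylow_subgroup p G K}"
    then have "sylow_subgroup p G ((\<lambda>h. inv x \<otimes> h \<otimes> x) ` K')"
      using sylow_subgroup_conj[OF _ fin x] by simp
    then have "h \<in> (\<lambda>h. inv x \<otimes> h \<otimes> x) ` K'" using h by blast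
    then obtain k where k: "k \<in> K'" "h = inv x \<otimes> k \<otimes> x" by blast
    moreover have "k \<in> carrier G"
      using k \<open>K' \<in> _\<close> by (auto simp: sylow_subgroup_def dest: subgroup.mem_carrier)
    ultimately have "x \<otimes> h \<otimes> inv x = k"
      using conj_cancel(1)[OF x] by simp
    then show "x \<otimes> h \<otimes> inv x \<in> K'" using k by simp
  qed
  have "?C \<subseteq> K" and subK: "subgroup K G"
    using K(1) by (auto simp: sylow_subgroup_def)
  then have "subgroup ?C (G\<lparr>carrier := K\<rparr>)"
    by (intro subgroup_incl sub)
  then have "card (rcosets\<^bsub>G\<lparr>carrier := K\<rparr>\<^esub> ?C) * card ?C = card K"
    using group.lagrange[OF subgroup_imp_group[OF subK], of ?C] by (simp add: order_def)
  then have "card ?C dvd card K"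
    by (metis dvd_triv_right)
  from this K(2) divides_primepow_nat[OF p, of "card ?C" n] obtain k where "card ?C = p ^ k"
    by fastforce
  then have P_C: "?P ?C"
    using P_iff[of ?C] norm by blast
  have max: "N \<subseteq> ?C" if "?P N" for N
    using that normal_p_subgroup_in_sylow[OF p fin] unfolding P_iff by blast
  have "p_core p G = ?C"
    unfolding p_core_def by (rule Greatest_equality) (use P_C max in auto)
  then show ?thesis
    using P_C max P_iff by metis
qed

section \<open>Calculation in partial groups\<close>

abbreviation word_inv :: "'a partial_group \<Rightarrow> 'a list \<Rightarrow> 'a list" where
  "word_inv L w \<equiv> rev (map (pg_inv L) w)"

context partial_group
begin

lemma word_closed: "w \<in> pg_words L \<Longrightarrow> set w \<subseteq> carrier L"
  using words_subset by (auto simp: in_lists_conv_set)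

lemma empty_word: "[] \<in> pg_words L"
proof -
  obtain f where "f \<in> carrier L" using nonempty by blast
  then show ?thesis using append_word[of "[]" "[f]"] singleton_word by simp
qed

lemma unit_closed: "pg_prod L [] \<in> carrier L"
  using prod_closed[OF empty_word] .

lemma prefix_word: "u @ v \<in> pg_words L \<Longrightarrow> u \<in> pg_words L"
  and suffix_word: "u @ v \<in> pg_words L \<Longrightarrow> v \<in> pg_words L"
  using append_word by blast+

lemma word_inv_closed: "set w \<subseteq> carrier L \<Longrightarrow> set (word_inv L w) \<subseteq> carrier L"
  using inv_closed by auto

lemma word_inv_word_inv: "set w \<subseteq> carrier L \<Longrightarrow> word_inv L (word_inv L w) = w"
  by (induction w) (auto simp: inv_inv)

lemma word_inv_in_words: "w \<in> pg_words L \<Longrightarrow> word_inv L w \<in> pg_words L"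
  using inverse_word prefix_word by blast

lemma word_append_inv:
  assumes "w \<in> pg_words L"
  shows "w @ word_inv L w \<in> pg_words L" "pg_prod L (w @ word_inv L w) = pg_prod L []"
  using inverse_word[OF word_inv_in_words[OF assms]] word_inv_word_inv[OF word_closed[OF assms]]
  by simp_all

lemma prod_append:
  assumes "u @ v \<in> pg_words L"
  shows "[pg_prod L u, pg_prod L v] \<in> pg_words L"
    "pg_prod L (u @ v) = pg_prod L [pg_prod L u, pg_prod L v]"
  using prod_assoc[of "[]" u v] prod_assoc[of "[pg_prod L u]" v "[]"] assms by auto

lemma prod_append3:
  assumes "u @ v @ w \<in> pg_words L"
  shows "[pg_prod L u, pg_prod L v, pg_prod L w] \<in> pg_words L"
    "pg_prod L (u @ v @ w) = pg_prod L [pg_prod L u, pg_prod L v, pg_prod L w]"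
  using prod_assoc[of "[]" u "v @ w"] prod_assoc[of "[pg_prod L u]" v w]
    prod_assoc[of "[pg_prod L u, pg_prod L v]" w "[]"] assms by auto

lemma prod_unit:
  assumes "f \<in> carrier L"
  shows "[pg_prod L [], f] \<in> pg_words L" "pg_prod L [pg_prod L [], f] = f"
    "[f, pg_prod L []] \<in> pg_words L" "pg_prod L [f, pg_prod L []] = f"
  using prod_assoc[of "[]" "[]" "[f]"] prod_assoc[of "[f]" "[]" "[]"]
    singleton_word[OF assms] prod_singleton[OF assms] by auto

text \<open>
  The axioms only allow a subword to be replaced by its product, not a product by its factors. To get rid of a
  unit, merge it with a neighbouring letter.
\<close>

lemma remove_unit:
  assumes "u @ [pg_prod L []] @ v \<in> pg_words L"
  shows "u @ v \<in> pg_words L \<and> pg_prod L (u @ [pg_prod L []] @ v) = pg_prod L (u @ v)"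
proof (cases u rule: rev_cases)
  case (snoc u' a)
  have "a \<in> carrier L" using word_closed[OF assms] snoc by simp
  then show ?thesis
    using prod_assoc[of u' "[a, pg_prod L []]" v] assms snoc prod_unit by simp
next
  case Nil
  show ?thesis
  proof (cases v)
    case (Cons b v')
    have "b \<in> carrier L" using word_closed[OF assms] Cons by simp
    then show ?thesis
      using prod_assoc[of "[]" "[pg_prod L [], b]" v'] assms Nil Cons prod_unit by simp
  qed (use Nil empty_word prod_singleton unit_closed in simp)
qed

lemma cancel_word:
  assumes "u @ v @ word_inv L v @ w \<in> pg_words L"
  shows "u @ w \<in> pg_words L" "pg_prod L (u @ v @ word_inv L v @ w) = pg_prod L (u @ w)"
proof -
  have "v \<in> pg_words L"
    using assms prefix_word suffix_word by blast
  then have "pg_prod L (v @ word_inv L v) = pg_prod L []"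
    by (rule word_append_inv)
  then have "u @ [pg_prod L []] @ w \<in> pg_words L"
    "pg_prod L (u @ v @ word_inv L v @ w) = pg_prod L (u @ [pg_prod L []] @ w)"
    using prod_assoc[of u "v @ word_inv L v" w] assms by auto
  then show "u @ w \<in> pg_words L" "pg_prod L (u @ v @ word_inv L v @ w) = pg_prod L (u @ w)"
    using remove_unit by auto
qed

text \<open>
  Cancellation keeps a word in the domain of the product, whereas inserting an inverse pair need not.
\<close>

lemma cancel_inv_left:
  assumes "u @ [pg_inv L a, a] @ w \<in> pg_words L"
  shows "u @ w \<in> pg_words L" "pg_prod L (u @ [pg_inv L a, a] @ w) = pg_prod L (u @ w)"
  using cancel_word[of u "[pg_inv L a]" w] assms word_closed[OF assms] inv_inv by auto

lemma cancel_inv_right: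
  assumes "u @ [a, pg_inv L a] @ w \<in> pg_words L"
  shows "u @ w \<in> pg_words L" "pg_prod L (u @ [a, pg_inv L a] @ w) = pg_prod L (u @ w)"
  using cancel_word[of u "[a]" w] assms by auto

lemma inv_unique:
  assumes "[f, g] \<in> pg_words L" "pg_prod L [f, g] = pg_prod L []"
  shows "f = pg_inv L g"
proof -
  have fg: "f \<in> carrier L" "g \<in> carrier L" using word_closed[OF assms(1)] by auto
  have w: "[f, g, pg_inv L g] \<in> pg_words L"
    using prefix_word[of "[f, g, pg_inv L g]" "[pg_inv L f]"] word_append_inv(1)[OF assms(1)] by simp
  then have "pg_prod L [f, g, pg_inv L g] = f"
    using cancel_inv_right(2)[of "[f]" g "[]"] prod_singleton fg by simp
  moreover have "pg_prod L [f, g, pg_inv L g] = pg_inv L g"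
    using prod_assoc[of "[]" "[f, g]" "[pg_inv L g]"] w assms(2) prod_unit inv_closed fg by simp
  ultimately show ?thesis by simp
qed

lemma inv_prod:
  assumes "w \<in> pg_words L"
  shows "pg_prod L (word_inv L w) = pg_inv L (pg_prod L w)"
  using prod_append[of "word_inv L w" w] inverse_word[OF assms] by (intro inv_unique) auto

text \<open>
  The point is that \<open>(g, g\<^sup>-\<^sup>1, x, g, g\<^sup>-\<^sup>1)\<close> can be multiplied as soon as \<open>(g\<^sup>-\<^sup>1, x, g)\<close> can. It is obtained by
  appending inverse words twice and passing to subwords.
\<close>

lemma conj_back:
  assumes x: "x \<in> pg_conj_dom L g" and g: "g \<in> carrier L"
  shows "pg_conj L g x \<in> pg_conj_dom L (pg_inv L g)"
    "pg_conj L (pg_inv L g) (pg_conj L g x) = x"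
    "[x, g] \<in> pg_words L" "[g, pg_conj L g x] \<in> pg_words L"
    "pg_prod L [g, pg_conj L g x] = pg_prod L [x, g]"
proof -
  have xL: "x \<in> carrier L" and w: "[pg_inv L g, x, g] \<in> pg_words L"
    using x by (auto simp: pg_conj_dom_def)
  have u: "[g, pg_inv L g, x, g] \<in> pg_words L"
    using inverse_word[OF w] suffix_word[of "[pg_inv L g, pg_inv L x]"] inv_inv[OF g] by simp
  have v: "[g, pg_inv L g, x, g, pg_inv L g] \<in> pg_words L"
    using word_append_inv(1)[OF u] prefix_word[of "[g, pg_inv L g, x, g, pg_inv L g]"] inv_inv[OF g]
    by simp
  have v': "pg_prod L [g, pg_inv L g, x, g, pg_inv L g] = x"
    using cancel_inv_right[of "[]" g "[x, g, pg_inv L g]"] cancel_inv_right[of "[x]" g "[]"] v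
      prod_singleton[OF xL] by simp
  show "pg_conj L g x \<in> pg_conj_dom L (pg_inv L g)"
    "pg_conj L (pg_inv L g) (pg_conj L g x) = x"
    using prod_assoc[of "[g]" "[pg_inv L g, x, g]" "[pg_inv L g]"] v v' inv_inv[OF g]
      prod_closed[OF w] by (auto simp: pg_conj_dom_def pg_conj_def)
  show "[x, g] \<in> pg_words L"
    using suffix_word[of "[pg_inv L g]" "[x, g]"] w by simp
  show "[g, pg_conj L g x] \<in> pg_words L"
    using prod_assoc[of "[g]" "[pg_inv L g, x, g]" "[]"] u by (auto simp: pg_conj_def)
  have "pg_prod L [g, pg_conj L g x] = pg_prod L [g, pg_inv L g, x, g]"
    using prod_assoc[of "[g]" "[pg_inv L g, x, g]" "[]"] u by (auto simp: pg_conj_def)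
  also have "\<dots> = pg_prod L [x, g]"
    using cancel_inv_right[of "[]" g "[x, g]"] u by simp
  finally show "pg_prod L [g, pg_conj L g x] = pg_prod L [x, g]" .
qed

lemma inj_on_conj: "g \<in> carrier L \<Longrightarrow> X \<subseteq> pg_conj_dom L g \<Longrightarrow> inj_on (pg_conj L g) X"
  by (rule inj_on_inverseI[where g = "pg_conj L (pg_inv L g)"]) (auto simp: conj_back(2))

lemma normalizer_inv:
  assumes "g \<in> pg_normalizer L X"
  shows "pg_inv L g \<in> pg_normalizer L X"
proof -
  have g: "g \<in> carrier L" "X \<subseteq> pg_conj_dom L g" "pg_conj L g ` X = X"
    using assms by (auto simp: pg_normalizer_def)
  have "X \<subseteq> pg_conj_dom L (pg_inv L g)"
    by (subst g(3)[symmetric]) (use conj_back(1)[OF _ g(1)] g(2) in auto)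
  moreover have "pg_conj L (pg_inv L g) ` (pg_conj L g ` X) = X"
    unfolding image_image using g(1,2) by (simp add: conj_back(2) subset_iff)
  ultimately show ?thesis
    using g inv_closed by (simp add: pg_normalizer_def)
qed

lemma centralizer_inv:
  assumes "g \<in> pg_centralizer L X"
  shows "pg_inv L g \<in> pg_centralizer L X"
proof -
  have g: "g \<in> carrier L"
    using assms by (simp add: pg_centralizer_def)
  have X: "x \<in> pg_conj_dom L g \<and> pg_conj L g x = x" if "x \<in> X" for x
    using assms that by (auto simp: pg_centralizer_def)
  have "x \<in> pg_conj_dom L (pg_inv L g) \<and> pg_conj L (pg_inv L g) x = x" if "x \<in> X" for x
    using conj_back(1,2)[of x g] g X[OF that] by auto
  then show ?thesis
    using assms inv_closed by (auto simp: pg_centralizer_def)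
qed

lemma pg_subgroup_word: "pg_subgroup L H \<Longrightarrow> set w \<subseteq> H \<Longrightarrow> w \<in> pg_words L"
  unfolding pg_subgroup_def by (meson in_listsI subset_iff)

lemma group_induced:
  assumes H: "pg_subgroup L H"
  shows "group (pg_induced_group L H)"
    "x \<in> H \<Longrightarrow> inv\<^bsub>pg_induced_group L H\<^esub> x = pg_inv L x"
proof -
  let ?G = "pg_induced_group L H"
  have words: "set w \<subseteq> H \<Longrightarrow> w \<in> pg_words L" for w
    using pg_subgroup_word[OF H] by blast
  have closed: "set w \<subseteq> H \<Longrightarrow> pg_prod L w \<in> H" for w
    using H words by (auto simp: pg_subgroup_def partial_subgroup_def)
  have HL: "H \<subseteq> carrier L" and inv_H: "x \<in> H \<Longrightarrow> pg_inv L x \<in> H" for x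
    using H by (auto simp: pg_subgroup_def partial_subgroup_def)
  have l_inv: "pg_prod L [pg_inv L x, x] = pg_prod L []" if "x \<in> H" for x
    using inverse_word[OF singleton_word, of x] HL that by auto
  show grp: "group ?G"
  proof (rule groupI)
    fix x y z assume "x \<in> carrier ?G" "y \<in> carrier ?G" "z \<in> carrier ?G"
    then have "[x, y, z] \<in> pg_words L"
      by (intro words) (simp add: pg_induced_group_def)
    then show "x \<otimes>\<^bsub>?G\<^esub> y \<otimes>\<^bsub>?G\<^esub> z = x \<otimes>\<^bsub>?G\<^esub> (y \<otimes>\<^bsub>?G\<^esub> z)"
      using prod_assoc[of "[]" "[x, y]" "[z]"] prod_assoc[of "[x]" "[y, z]" "[]"]
      by (simp add: pg_induced_group_def)
  next
    fix x assume "x \<in> carrier ?G"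
    then show "\<one>\<^bsub>?G\<^esub> \<otimes>\<^bsub>?G\<^esub> x = x" "\<exists>y\<in>carrier ?G. y \<otimes>\<^bsub>?G\<^esub> x = \<one>\<^bsub>?G\<^esub>"
      using l_inv inv_H prod_unit HL by (auto simp: pg_induced_group_def)
  qed (use closed in \<open>auto simp: pg_induced_group_def\<close>)
  show "inv\<^bsub>?G\<^esub> x = pg_inv L x" if "x \<in> H"
    using group.inv_equality[OF grp, of "pg_inv L x" x] l_inv[OF that] inv_H that
    by (simp add: pg_induced_group_def)
qed

lemma induced_conj:
  assumes H: "pg_subgroup L H" and "x \<in> H" "g \<in> H"
  shows "x \<in> pg_conj_dom L g"
    "pg_conj L g x = inv\<^bsub>pg_induced_group L H\<^esub> g \<otimes>\<^bsub>pg_induced_group L H\<^esub> x \<otimes>\<^bsub>pg_induced_group L H\<^esub> g"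
proof -
  have "pg_inv L g \<in> H" "H \<subseteq> carrier L"
    using H assms by (auto simp: pg_subgroup_def partial_subgroup_def)
  moreover then have w: "[pg_inv L g, x, g] \<in> pg_words L"
    using H assms by (auto simp: pg_subgroup_def)
  ultimately show "x \<in> pg_conj_dom L g"
    using assms by (auto simp: pg_conj_dom_def)
  show "pg_conj L g x = inv\<^bsub>pg_induced_group L H\<^esub> g \<otimes>\<^bsub>pg_induced_group L H\<^esub> x \<otimes>\<^bsub>pg_induced_group L H\<^esub> g"
    using prod_assoc[of "[]" "[pg_inv L g, x]" "[g]"] w group_induced(2)[OF H] assms
    by (simp add: pg_conj_def pg_induced_group_def)
qed

text \<open>
  This allows the theory of finite groups to be applied inside a subgroup \<open>H\<close> of a partial group
  and its results to be read in the partial group.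
\<close>

lemma subgroup_induced_iff:
  assumes H: "pg_subgroup L H"
  shows "subgroup K (pg_induced_group L H) \<longleftrightarrow> pg_subgroup L K \<and> K \<subseteq> H"
proof
  assume K: "subgroup K (pg_induced_group L H)"
  have KH: "K \<subseteq> H"
    using subgroup.subset[OF K] by (simp add: pg_induced_group_def)
  have words: "set w \<subseteq> K \<Longrightarrow> w \<in> pg_words L" for w
    using pg_subgroup_word[OF H] KH by blast
  have "pg_prod L w \<in> K" if "set w \<subseteq> K" for w
    using that
  proof (induction w)
    case Nil
    then show ?case using subgroup.one_closed[OF K] by (simp add: pg_induced_group_def)
  next
    case (Cons x w)
    have "pg_prod L (x # w) = pg_prod L [x, pg_prod L w]"
      using prod_assoc[of "[x]" w "[]"] words[OF Cons.prems] by simp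
    then show ?case
      using Cons subgroup.m_closed[OF K, of x "pg_prod L w"] by (simp add: pg_induced_group_def)
  qed
  moreover have "pg_inv L x \<in> K" if "x \<in> K" for x
    using subgroup.m_inv_closed[OF K that] group_induced(2)[OF H] that KH by auto
  ultimately show "pg_subgroup L K \<and> K \<subseteq> H"
    using words KH H by (auto simp: pg_subgroup_def partial_subgroup_def in_lists_conv_set subset_iff)
next
  assume K: "pg_subgroup L K \<and> K \<subseteq> H"
  then have words: "set w \<subseteq> K \<Longrightarrow> w \<in> pg_words L" for w
    using pg_subgroup_word by blast
  have closed: "set w \<subseteq> K \<Longrightarrow> pg_prod L w \<in> K" for w
    using K words by (auto simp: pg_subgroup_def partial_subgroup_def)
  show "subgroup K (pg_induced_group L H)"
  proof (rule group.subgroupI[OF group_induced(1)[OF H]])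
    show "K \<noteq> {}" using closed[of "[]"] by auto
    show "inv\<^bsub>pg_induced_group L H\<^esub> x \<in> K" if "x \<in> K" for x
      using K that group_induced(2)[OF H] by (auto simp: pg_subgroup_def partial_subgroup_def)
  qed (use K closed in \<open>auto simp: pg_induced_group_def\<close>)
qed

lemma pg_subgroup_Int:
  assumes "pg_subgroup L H" "pg_subgroup L K"
  shows "pg_subgroup L (H \<inter> K)"
  using assms by (auto simp: pg_subgroup_def partial_subgroup_def)

end

section \<open>Conjugation along words\<close>

primrec conj_along :: "'a partial_group \<Rightarrow> 'a list \<Rightarrow> 'a \<Rightarrow> 'a" where
  "conj_along L [] x = x"
| "conj_along L (g # w) x = conj_along L w (pg_conj L g x)"

lemma conj_along_append: "conj_along L (u @ v) x = conj_along L v (conj_along L u x)"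
  by (induction u arbitrary: x) auto

primrec stays :: "'a partial_group \<Rightarrow> 'a set \<Rightarrow> 'a list \<Rightarrow> 'a \<Rightarrow> bool" where
  "stays L T [] x \<longleftrightarrow> x \<in> T"
| "stays L T (g # w) x \<longleftrightarrow> x \<in> T \<and> x \<in> pg_conj_dom L g \<and> stays L T w (pg_conj L g x)"

text \<open>
  For \<open>T = S\<close> and a word with the single letter \<open>g\<close> this is the set usually called \<open>S\<^sub>g\<close>.
\<close>

definition source :: "'a partial_group \<Rightarrow> 'a set \<Rightarrow> 'a list \<Rightarrow> 'a set" where
  "source L T w = {x. stays L T w x}"

lemma stays_start: "stays L T w x \<Longrightarrow> x \<in> T"
  by (cases w) auto

lemma stays_append: "stays L T (u @ v) x \<longleftrightarrow> stays L T u x \<and> stays L T v (conj_along L u x)"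
  by (induction u arbitrary: x) (auto dest: stays_start)

lemma source_Nil: "source L T [] = T"
  by (auto simp: source_def)

lemma source_Cons: "source L T (g # w) = {x \<in> source L T [g]. pg_conj L g x \<in> source L T w}"
  by (auto simp: source_def dest: stays_start)

lemma source_single: "x \<in> source L T [g] \<longleftrightarrow> x \<in> T \<and> x \<in> pg_conj_dom L g \<and> pg_conj L g x \<in> T"
  by (simp add: source_def)

lemma source_append: "x \<in> source L T (u @ v) \<longleftrightarrow> x \<in> source L T u \<and> conj_along L u x \<in> source L T v"
  by (simp add: source_def stays_append)

lemma source_subset: "source L T w \<subseteq> T"
  by (auto simp: source_def dest: stays_start)

lemma conj_along_in_target: "x \<in> source L T w \<Longrightarrow> conj_along L w x \<in> T"
  unfolding source_def by (induction w arbitrary: x) auto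

lemma (in partial_group) source_word_inv:
  assumes "set w \<subseteq> carrier L" "x \<in> source L T w"
  shows "conj_along L w x \<in> source L T (word_inv L w)" "conj_along L (word_inv L w) (conj_along L w x) = x"
proof -
  have "conj_along L w x \<in> source L T (word_inv L w) \<and> conj_along L (word_inv L w) (conj_along L w x) = x"
    using assms
  proof (induction w arbitrary: x)
    case (Cons g w)
    have g: "g \<in> carrier L" "x \<in> T" "x \<in> pg_conj_dom L g" "pg_conj L g x \<in> source L T w"
      using Cons.prems by (auto simp: source_def)
    have "pg_conj L g x \<in> source L T [pg_inv L g]"
      using conj_back(1,2)[OF g(3,1)] g(2) subsetD[OF source_subset g(4)] by (simp add: source_single)
    then show ?case
      using Cons.IH[OF _ g(4)] Cons.prems(1) conj_back(2)[OF g(3,1)]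
      by (simp add: source_append conj_along_append)
  qed (auto simp: source_Nil)
  then show "conj_along L w x \<in> source L T (word_inv L w)" "conj_along L (word_inv L w) (conj_along L w x) = x" by auto
qed

lemma (in partial_group) inj_on_conj_along: "set w \<subseteq> carrier L \<Longrightarrow> inj_on (conj_along L w) (source L T w)"
  by (rule inj_on_inverseI[where g = "conj_along L (word_inv L w)"]) (rule source_word_inv(2))

text \<open>
  Evaluate \<open>w\<^sup>-\<^sup>1 \<circ> (x) \<circ> w\<close> in two ways: from the inside outwards, one letter of \<open>w\<close> at a time, and by
  multiplying \<open>w\<^sup>-\<^sup>1\<close> and \<open>w\<close> first.
\<close>

lemma (in partial_group) conj_word_prod:
  assumes "word_inv L w @ [x] @ w \<in> pg_words L" "set w \<subseteq> carrier L"
  shows "pg_prod L (word_inv L w @ [x] @ w) = conj_along L w x"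
    "x \<in> pg_conj_dom L (pg_prod L w)" "pg_conj L (pg_prod L w) x = conj_along L w x"
proof -
  have "pg_prod L (word_inv L w @ [x] @ w) = conj_along L w x"
    using assms
  proof (induction w arbitrary: x)
    case Nil
    then show ?case using word_closed[OF Nil(1)] by (simp add: prod_singleton)
  next
    case (Cons g w)
    have eq: "word_inv L (g # w) @ [x] @ g # w = word_inv L w @ [pg_inv L g, x, g] @ w"
      by simp
    have "word_inv L w @ [pg_conj L g x] @ w \<in> pg_words L \<and>
        pg_prod L (word_inv L (g # w) @ [x] @ g # w) = pg_prod L (word_inv L w @ [pg_conj L g x] @ w)"
      using prod_assoc[of "word_inv L w" "[pg_inv L g, x, g]" w] Cons.prems(1)
      unfolding eq pg_conj_def by blast
    then show ?case
      using Cons.IH[of "pg_conj L g x"] Cons.prems(2) by simp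
  qed
  moreover have "x \<in> carrier L" "w \<in> pg_words L"
    using word_closed[OF assms(1)] suffix_word[of "word_inv L w @ [x]" w] assms(1) by auto
  ultimately show "pg_prod L (word_inv L w @ [x] @ w) = conj_along L w x"
    "x \<in> pg_conj_dom L (pg_prod L w)" "pg_conj L (pg_prod L w) x = conj_along L w x"
    using prod_append3[OF assms(1)] inv_prod[of w] prod_singleton[of x]
    by (auto simp: pg_conj_dom_def pg_conj_def)
qed

section \<open>Localities\<close>

text \<open>
  The locality axioms fix the multiplication of \<open>S\<close> on its carrier only; that \<open>S\<close> is a group determines its
  unit, and hence its inverses, too.
\<close>

locale p_locality = locality p L \<Delta> S + S: group S for p :: nat and L :: "'a partial_group" and \<Delta> and S :: "'a monoid" +
  assumes prime_p: "prime p"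
begin

abbreviation src :: "'a list \<Rightarrow> 'a set" where "src \<equiv> source L (carrier S)"

lemma S_subgroup: "pg_subgroup L (carrier S)"
  using S_p_subgroup by (simp add: pg_p_subgroup_def)

lemma S_closed: "carrier S \<subseteq> carrier L"
  using S_subgroup by (simp add: pg_subgroup_def partial_subgroup_def)

lemma finite_S: "finite (carrier S)"
  using finite_carrier S_closed finite_subset by blast

lemma S_word: "set w \<subseteq> carrier S \<Longrightarrow> w \<in> pg_words L"
  using S_subgroup by (auto simp: pg_subgroup_def)

lemma S_one: "\<one>\<^bsub>S\<^esub> = pg_prod L []"
proof -
  let ?e = "\<one>\<^bsub>S\<^esub>"
  have e: "?e \<in> carrier L" "pg_inv L ?e \<in> carrier S"
    using S_closed S_subgroup by (auto simp: pg_subgroup_def partial_subgroup_def)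
  have w: "[pg_inv L ?e, ?e, ?e] \<in> pg_words L"
    using e by (intro S_word) auto
  have "pg_prod L [pg_inv L ?e, ?e, ?e] = ?e"
    using cancel_inv_left(2)[of "[]" ?e "[?e]"] w prod_singleton[OF e(1)] by simp
  moreover have "pg_prod L [pg_inv L ?e, ?e, ?e] = pg_prod L [pg_inv L ?e, ?e]"
    using prod_assoc[of "[pg_inv L ?e]" "[?e, ?e]" "[]"] w S_mult[of ?e ?e] by simp
  moreover have "pg_prod L [pg_inv L ?e, ?e] = pg_prod L []"
    using inverse_word[OF singleton_word[OF e(1)]] by simp
  ultimately show ?thesis by simp
qed

lemma S_inv: "x \<in> carrier S \<Longrightarrow> inv\<^bsub>S\<^esub> x = pg_inv L x"
  using inv_unique[of "inv\<^bsub>S\<^esub> x" x] S_word[of "[inv\<^bsub>S\<^esub> x, x]"] S_mult[of "inv\<^bsub>S\<^esub> x" x] S_one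
  by simp

lemma subgroup_S_iff: "subgroup P S \<longleftrightarrow> pg_subgroup L P \<and> P \<subseteq> carrier S"
proof -
  have "subgroup P S \<longleftrightarrow> subgroup P (pg_induced_group L (carrier S))"
    using S_mult S_one S_inv group_induced(2)[OF S_subgroup] S.m_closed
    by (auto simp: subgroup_def pg_induced_group_def subset_iff)
  then show ?thesis
    using subgroup_induced_iff[OF S_subgroup] by simp
qed

lemma S_conj:
  assumes "x \<in> carrier S" "s \<in> carrier S"
  shows "x \<in> pg_conj_dom L s" "pg_conj L s x = inv\<^bsub>S\<^esub> s \<otimes>\<^bsub>S\<^esub> x \<otimes>\<^bsub>S\<^esub> s"
    "pg_conj L s x \<in> carrier S"
proof -
  have inv: "pg_inv L s \<in> carrier S"
    using S_subgroup assms by (auto simp: pg_subgroup_def partial_subgroup_def)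
  then have w: "[pg_inv L s, x, s] \<in> pg_words L"
    using assms by (intro S_word) auto
  then show "x \<in> pg_conj_dom L s"
    using assms S_closed by (auto simp: pg_conj_dom_def)
  show eq: "pg_conj L s x = inv\<^bsub>S\<^esub> s \<otimes>\<^bsub>S\<^esub> x \<otimes>\<^bsub>S\<^esub> s"
    using prod_assoc[of "[]" "[pg_inv L s, x]" "[s]"] w assms S_inv[OF assms(2)] S_mult[OF inv assms(1)]
      S_mult[of "pg_inv L s \<otimes>\<^bsub>S\<^esub> x" s] S.m_closed[OF inv assms(1)]
    by (simp add: pg_conj_def)
  then show "pg_conj L s x \<in> carrier S"
    using assms by simp
qed

lemma objects_subset: "P \<in> \<Delta> \<Longrightarrow> P \<subseteq> carrier S"
  using objects_subgroups subgroup.subset by blast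

lemma object_conj_along:
  assumes "P \<in> \<Delta>" "P \<subseteq> src w" "set w \<subseteq> carrier L"
  shows "conj_along L w ` P \<in> \<Delta>"
  using assms
proof (induction w arbitrary: P)
  case (Cons g w)
  have "P \<subseteq> pg_conj_dom L g" "pg_conj L g ` P \<subseteq> carrier S" "pg_conj L g ` P \<subseteq> src w"
    using Cons.prems(2) source_single source_subset by (force simp: source_Cons[of L "carrier S" g w])+
  then have "pg_conj L g ` P \<in> \<Delta>"
    using objects_conj Cons.prems by simp
  then have "conj_along L w ` pg_conj L g ` P \<in> \<Delta>"
    using Cons.IH \<open>pg_conj L g ` P \<subseteq> src w\<close> Cons.prems by simp
  then show ?case by (simp add: image_image)
qed simp

text \<open>
  The chain of objects in the definition of a locality is determined by its first member \<open>P\<close>, and the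
  condition on \<open>P\<close> becomes a condition on its elements.
\<close>

lemma word_iff_object: "w \<in> pg_words L \<longleftrightarrow> set w \<subseteq> carrier L \<and> (\<exists>P\<in>\<Delta>. P \<subseteq> src w)"
proof
  assume w: "w \<in> pg_words L"
  have "P 0 \<subseteq> src w"
    if "\<forall>i \<le> length w. P i \<in> \<Delta>"
      "\<forall>i < length w. P i \<subseteq> pg_conj_dom L (w ! i) \<and> pg_conj L (w ! i) ` P i = P (Suc i)" for P
    using that
  proof (induction w arbitrary: P)
    case Nil
    then show ?case using objects_subset by (simp add: source_Nil)
  next
    case (Cons g w)
    have P0: "P 0 \<in> \<Delta>" "P 0 \<subseteq> pg_conj_dom L g" "pg_conj L g ` P 0 = P (Suc 0)"
      using Cons.prems(1)[rule_format, of 0] Cons.prems(2)[rule_format, of 0] by simp_all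
    have "P (Suc 0) \<subseteq> src w"
    proof (rule Cons.IH[of "\<lambda>i. P (Suc i)"]; intro allI impI)
      show "P (Suc i) \<in> \<Delta>" if "i \<le> length w" for i
        using Cons.prems(1) that by simp
      show "P (Suc i) \<subseteq> pg_conj_dom L (w ! i) \<and> pg_conj L (w ! i) ` P (Suc i) = P (Suc (Suc i))"
        if "i < length w" for i
        using Cons.prems(2)[rule_format, of "Suc i"] that by simp
    qed
    then have "x \<in> carrier S \<and> x \<in> pg_conj_dom L g \<and> pg_conj L g x \<in> src w" if "x \<in> P 0" for x
      using that P0 objects_subset[OF P0(1)] by blast
    then show ?case
      by (auto simp: source_def)
  qed
  moreover obtain P where P: "\<forall>i \<le> length w. P i \<in> \<Delta>"
      "\<forall>i < length w. P i \<subseteq> pg_conj_dom L (w ! i) \<and> pg_conj L (w ! i) ` P i = P (Suc i)"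
    using w words_iff[of w] by blast
  ultimately have "P 0 \<subseteq> src w" by blast
  moreover have "P 0 \<in> \<Delta>" using P(1) by simp
  ultimately show "set w \<subseteq> carrier L \<and> (\<exists>P\<in>\<Delta>. P \<subseteq> src w)"
    using word_closed[OF w] by blast
next
  assume w: "set w \<subseteq> carrier L \<and> (\<exists>P\<in>\<Delta>. P \<subseteq> src w)"
  then obtain P where P: "P \<in> \<Delta>" "P \<subseteq> src w" by blast
  have split: "P \<subseteq> src (take i w) \<and> conj_along L (take i w) ` P \<subseteq> src (drop i w)" for i
    using P(2) source_append[of _ L "carrier S" "take i w" "drop i w"] by auto
  show "w \<in> pg_words L"
    unfolding words_iff
  proof (intro conjI exI[of _ "\<lambda>i. conj_along L (take i w) ` P"] allI impI)
    show "w \<in> lists (carrier L)" using w by (auto simp: in_lists_conv_set)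
  next
    fix i
    show "conj_along L (take i w) ` P \<in> \<Delta>"
      using split w set_take_subset by (intro object_conj_along P(1)) fastforce+
  next
    fix i assume i: "i < length w"
    show "conj_along L (take i w) ` P \<subseteq> pg_conj_dom L (w ! i)"
      using split[of i] i by (force simp: Cons_nth_drop_Suc[symmetric] source_def)
    show "pg_conj L (w ! i) ` conj_along L (take i w) ` P = conj_along L (take (Suc i) w) ` P"
      using i by (auto simp: take_Suc_conv_app_nth conj_along_append)
  qed
qed

lemma wordI: "\<lbrakk>set w \<subseteq> carrier L; P \<in> \<Delta>; P \<subseteq> src w\<rbrakk> \<Longrightarrow> w \<in> pg_words L"
  using word_iff_object by blast

text \<open>
  The word can be multiplied via the image of \<open>P\<close>: going back along \<open>w\<close> leads to \<open>P\<close>, which \<open>x\<close>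
  maps to itself, and then \<open>w\<close> leads to the image again. So conjugation along \<open>w\<close> makes sense not
  only on \<open>P\<close> but on its whole normalizer, which need not lie in \<open>S\<close>.
\<close>

lemma conj_normalizer_word:
  assumes P: "P \<in> \<Delta>" "P \<subseteq> src w" and w: "set w \<subseteq> carrier L" and x: "x \<in> pg_normalizer L P"
  shows "word_inv L w @ [x] @ w \<in> pg_words L"
proof (rule wordI[OF _ object_conj_along[OF P w]])
  have x': "x \<in> carrier L" "P \<subseteq> pg_conj_dom L x" "pg_conj L x ` P = P"
    using x by (auto simp: pg_normalizer_def)
  then show "set (word_inv L w @ [x] @ w) \<subseteq> carrier L"
    using word_inv_closed[OF w] w by auto
  show "conj_along L w ` P \<subseteq> src (word_inv L w @ [x] @ w)"
  proof
    fix y assume "y \<in> conj_along L w ` P"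
    then obtain z where z: "z \<in> P" "y = conj_along L w z" by blast
    then have "y \<in> src (word_inv L w)" "conj_along L (word_inv L w) y = z"
      using source_word_inv[OF w] P by auto
    moreover have "z \<in> src [x]" "pg_conj L x z \<in> src w"
      using x' z(1) objects_subset[OF P(1)] P(2) by (auto simp: source_single)
    ultimately show "y \<in> src (word_inv L w @ [x] @ w)"
      unfolding source_append by simp
  qed
qed

lemma conj_normalizer:
  assumes P: "P \<in> \<Delta>" "P \<subseteq> src w" and w: "set w \<subseteq> carrier L" and x: "x \<in> pg_normalizer L P"
  shows "x \<in> pg_conj_dom L (pg_prod L w)" "pg_conj L (pg_prod L w) x = conj_along L w x"
  using conj_word_prod(2,3)[OF conj_normalizer_word[OF assms] w] by auto

lemma object_in_normalizer:
  assumes P: "P \<in> \<Delta>"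
  shows "P \<subseteq> pg_normalizer L P"
proof
  fix x assume x: "x \<in> P"
  have PS: "subgroup P S" and sub: "pg_subgroup L P" "P \<subseteq> carrier S"
    using objects_subgroups[OF P] subgroup_S_iff by auto
  have dom: "P \<subseteq> pg_conj_dom L x" and into: "pg_conj L x ` P \<subseteq> P"
    using S_conj sub x PS by (auto simp: subset_iff subgroup.m_closed subgroup.m_inv_closed)
  have "inj_on (pg_conj L x) P"
    using inj_on_conj[OF _ dom] x sub S_closed by blast
  then have "pg_conj L x ` P = P"
    using into finite_subset[OF sub(2) finite_S] by (metis endo_inj_surj)
  then show "x \<in> pg_normalizer L P"
    using dom x sub S_closed by (auto simp: pg_normalizer_def)
qed

lemma source_object:
  assumes "g \<in> carrier L"
  obtains P where "P \<in> \<Delta>" "P \<subseteq> src [g]"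
  using singleton_word[OF assms] word_iff_object[of "[g]"] that by blast

text \<open>
  This is the step that makes \<open>S\<^sub>g\<close> closed under multiplication. With \<open>b = a\<^sup>g \<in> S\<close> one has \<open>a g = g b\<close>, so
  \<open>g\<close> is the product of \<open>(a\<^sup>-\<^sup>1, g, b)\<close>, and along this word the object \<open>P\<^sup>a\<close> stays in \<open>S\<close>: it goes to
  \<open>P\<close>, then to \<open>P\<^sup>g\<close>, and \<open>b\<close> lies in \<open>S\<close>.
\<close>

lemma source_conj_closed:
  assumes g: "g \<in> carrier L" and a: "a \<in> src [g]" and P: "P \<in> \<Delta>" "P \<subseteq> src [g]"
  shows "pg_conj L a ` P \<subseteq> src [g]" "pg_conj L a ` P \<in> \<Delta>"
proof -
  let ?b = "pg_conj L g a" and ?u = "[pg_inv L a, g, pg_conj L g a]"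
  have aS: "a \<in> carrier S" "a \<in> pg_conj_dom L g" "?b \<in> carrier S" "a \<in> carrier L" "?b \<in> carrier L"
    using a S_closed by (auto simp: source_single)
  have PS: "P \<subseteq> carrier S" using objects_subset[OF P(1)] .
  show Pa: "pg_conj L a ` P \<in> \<Delta>"
    using S_conj(1,3)[OF _ aS(1)] PS by (intro objects_conj[OF P(1) aS(4)]) auto
  have u_src: "pg_conj L a ` P \<subseteq> src ?u"
  proof
    fix y assume "y \<in> pg_conj L a ` P"
    then obtain z where z: "z \<in> P" "y = pg_conj L a z" by blast
    then have "y \<in> carrier S" "y \<in> pg_conj_dom L (pg_inv L a)" "pg_conj L (pg_inv L a) y = z"
      using S_conj[OF _ aS(1)] PS conj_back[OF _ aS(4), of z] by auto
    then show "y \<in> src ?u"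
      using z P(2) S_conj[OF _ aS(3), of "pg_conj L g z"]
      by (auto simp: source_def subset_iff)
  qed
  have u_car: "set ?u \<subseteq> carrier L"
    using aS g inv_closed by auto
  have u: "?u \<in> pg_words L"
    using wordI[OF u_car Pa u_src] .
  have ag: "[a, g] \<in> pg_words L" "pg_prod L [g, ?b] = pg_prod L [a, g]"
    using conj_back(3,5)[OF aS(2) g] .
  have v: "[pg_inv L a, a, g] \<in> pg_words L"
    using inverse_word[OF ag(1)] suffix_word[of "[pg_inv L g]" "[pg_inv L a, a, g]"] by simp
  have "pg_prod L ?u = pg_prod L [pg_inv L a, pg_prod L [a, g]]"
    using prod_assoc[of "[pg_inv L a]" "[g, ?b]" "[]"] u ag(2) by simp
  also have "\<dots> = pg_prod L [pg_inv L a, a, g]"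
    using prod_assoc[of "[pg_inv L a]" "[a, g]" "[]"] v by simp
  also have "\<dots> = g"
    using cancel_inv_left[of "[]" a "[g]"] v prod_singleton[OF g] by simp
  finally have prod_u: "pg_prod L ?u = g" .
  show "pg_conj L a ` P \<subseteq> src [g]"
  proof
    fix y assume y: "y \<in> pg_conj L a ` P"
    then have "y \<in> pg_conj_dom L g" "pg_conj L g y = conj_along L ?u y"
      using conj_normalizer[OF Pa u_src u_car, of y] object_in_normalizer[OF Pa] prod_u by auto
    then show "y \<in> src [g]"
      using u_src y conj_along_in_target[of y L "carrier S" ?u] source_subset[of L "carrier S" ?u]
      unfolding source_single by auto
  qed
qed

text \<open>
  Both \<open>a\<^sup>g b\<^sup>g\<close> and \<open>(a b)\<^sup>g\<close> are the product of \<open>(g\<^sup>-\<^sup>1, a, g, g\<^sup>-\<^sup>1, b, g)\<close>. If \<open>P\<close> is an object in \<open>S\<^sub>g\<close>, then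
  \<open>P\<^sup>g\<close> stays in \<open>S\<close> along this word, since \<open>P\<^sup>a\<close> and its conjugate by \<open>b\<close> remain in \<open>S\<^sub>g\<close>.
\<close>

lemma source_mult:
  assumes g: "g \<in> carrier L" and a: "a \<in> src [g]" and b: "b \<in> src [g]"
  shows "a \<otimes>\<^bsub>S\<^esub> b \<in> src [g]" "pg_conj L g (a \<otimes>\<^bsub>S\<^esub> b) = pg_conj L g a \<otimes>\<^bsub>S\<^esub> pg_conj L g b"
proof -
  obtain P where P: "P \<in> \<Delta>" "P \<subseteq> src [g]" using source_object[OF g] .
  have aS: "a \<in> carrier S" "b \<in> carrier S" "pg_conj L g a \<in> carrier S" "pg_conj L g b \<in> carrier S"
    using a b by (auto simp: source_single)
  let ?v = "[pg_inv L g, a, g, pg_inv L g, b, g]"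
  have Pg: "pg_conj L g ` P \<in> \<Delta>"
    using object_conj_along[OF P] g by simp
  have v: "?v \<in> pg_words L"
  proof (rule wordI[OF _ Pg])
    show "set ?v \<subseteq> carrier L" using aS S_closed g inv_closed by auto
    show "pg_conj L g ` P \<subseteq> src ?v"
    proof
      fix y assume "y \<in> pg_conj L g ` P"
      then obtain z where z: "z \<in> P" "y = pg_conj L g z" by blast
      let ?z1 = "pg_conj L a z"
      let ?z2 = "pg_conj L b ?z1"
      note c1 = source_conj_closed[OF g a P]
      have src: "z \<in> src [g]" "?z1 \<in> src [g]" "?z2 \<in> src [g]"
        using P(2) z(1) c1 source_conj_closed(1)[OF g b c1(2,1)] by auto
      have bk: "pg_conj L g t \<in> carrier S" "pg_conj L g t \<in> pg_conj_dom L (pg_inv L g)"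
        "pg_conj L (pg_inv L g) (pg_conj L g t) = t" "t \<in> carrier S" "t \<in> pg_conj_dom L g"
        if "t \<in> src [g]" for t
        using that conj_back(1,2)[OF _ g, of t] by (auto simp: source_single)
      show "y \<in> src ?v"
        using bk[OF src(1)] bk[OF src(2)] bk[OF src(3)] z(2) S_conj(1)[OF _ aS(1)] S_conj(1)[OF _ aS(2)]
        by (simp add: source_def)
    qed
  qed
  have 1: "pg_prod L ?v = pg_prod L [pg_conj L g a, pg_conj L g b]"
    using prod_append[of "[pg_inv L g, a, g]" "[pg_inv L g, b, g]"] v by (simp add: pg_conj_def)
  have 2: "[pg_inv L g, a, b, g] \<in> pg_words L" "pg_prod L ?v = pg_prod L [pg_inv L g, a, b, g]"
    using cancel_inv_right[of "[pg_inv L g, a]" g "[b, g]"] v by auto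
  have 3: "[pg_inv L g, a \<otimes>\<^bsub>S\<^esub> b, g] \<in> pg_words L"
    "pg_prod L [pg_inv L g, a, b, g] = pg_prod L [pg_inv L g, a \<otimes>\<^bsub>S\<^esub> b, g]"
    using prod_assoc[of "[pg_inv L g]" "[a, b]" "[g]"] 2(1) S_mult[OF aS(1,2)] by auto
  show eq: "pg_conj L g (a \<otimes>\<^bsub>S\<^esub> b) = pg_conj L g a \<otimes>\<^bsub>S\<^esub> pg_conj L g b"
    using 1 2 3 S_mult[OF aS(3,4)] by (simp add: pg_conj_def)
  show "a \<otimes>\<^bsub>S\<^esub> b \<in> src [g]"
    using 3(1) aS S_closed eq by (auto simp: source_single pg_conj_dom_def)
qed

lemma source_single_subgroup:
  assumes g: "g \<in> carrier L"
  shows "subgroup (src [g]) S"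
proof (rule S.subgroupI)
  obtain P where P: "P \<in> \<Delta>" "P \<subseteq> src [g]" using source_object[OF g] .
  then show "src [g] \<noteq> {}"
    using subgroup.one_closed[OF objects_subgroups[OF P(1)]] by blast
next
  fix a assume a: "a \<in> src [g]"
  then have aS: "a \<in> carrier S" "[pg_inv L g, a, g] \<in> pg_words L" "pg_conj L g a \<in> carrier S"
    by (auto simp: source_single pg_conj_dom_def)
  have "[pg_inv L g, inv\<^bsub>S\<^esub> a, g] \<in> pg_words L"
    "pg_prod L [pg_inv L g, inv\<^bsub>S\<^esub> a, g] = inv\<^bsub>S\<^esub> (pg_conj L g a)"
    using word_inv_in_words[OF aS(2)] inv_prod[OF aS(2)] aS S_inv inv_inv[OF g]
    by (auto simp: pg_conj_def)
  then show "inv\<^bsub>S\<^esub> a \<in> src [g]"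
    using aS S_closed by (auto simp: source_single pg_conj_dom_def pg_conj_def)
qed (use source_mult[OF g] in \<open>auto simp: source_single\<close>)

lemma source_subgroup: "set w \<subseteq> carrier L \<Longrightarrow> subgroup (src w) S"
  and conj_along_mult: "\<lbrakk>set w \<subseteq> carrier L; x \<in> src w; y \<in> src w\<rbrakk> \<Longrightarrow>
    conj_along L w (x \<otimes>\<^bsub>S\<^esub> y) = conj_along L w x \<otimes>\<^bsub>S\<^esub> conj_along L w y"
proof -
  have "subgroup (src w) S \<and>
      (\<forall>x\<in>src w. \<forall>y\<in>src w. conj_along L w (x \<otimes>\<^bsub>S\<^esub> y) = conj_along L w x \<otimes>\<^bsub>S\<^esub> conj_along L w y)"
    if "set w \<subseteq> carrier L" for w
    using that
  proof (induction w)
    case Nil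
    then show ?case by (simp add: source_Nil S.subgroup_self)
  next
    case (Cons g w)
    then have g: "g \<in> carrier L" and IH: "subgroup (src w) S"
        "\<And>x y. \<lbrakk>x\<in>src w; y\<in>src w\<rbrakk> \<Longrightarrow> conj_along L w (x \<otimes>\<^bsub>S\<^esub> y) = conj_along L w x \<otimes>\<^bsub>S\<^esub> conj_along L w y"
      by auto
    note sg = source_single_subgroup[OF g]
    let ?c = "pg_conj L g"
    have one: "?c \<one>\<^bsub>S\<^esub> = \<one>\<^bsub>S\<^esub>"
      using source_mult(2)[OF g subgroup.one_closed[OF sg] subgroup.one_closed[OF sg]]
        subgroup.one_closed[OF sg] S.l_cancel_one'[of "?c \<one>\<^bsub>S\<^esub>" "?c \<one>\<^bsub>S\<^esub>"]
      by (auto simp: source_single)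
    have "subgroup (src (g # w)) S"
    proof (rule S.subgroupI)
      show "src (g # w) \<subseteq> carrier S" by (rule source_subset)
      show "src (g # w) \<noteq> {}"
        using one subgroup.one_closed[OF sg] subgroup.one_closed[OF IH(1)]
        by (auto simp: source_Cons[of L _ g w])
    next
      fix x assume "x \<in> src (g # w)"
      then have x: "x \<in> src [g]" "?c x \<in> src w" "x \<in> carrier S" "?c x \<in> carrier S"
        unfolding source_Cons[of L _ g w] using source_subset[of L "carrier S"] by auto
      have ix: "inv\<^bsub>S\<^esub> x \<in> src [g]"
        using subgroup.m_inv_closed[OF sg x(1)] .
      then have "?c (inv\<^bsub>S\<^esub> x) \<otimes>\<^bsub>S\<^esub> ?c x = \<one>\<^bsub>S\<^esub>"
        using source_mult(2)[OF g ix x(1)] one x(3) by simp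
      then have "?c (inv\<^bsub>S\<^esub> x) = inv\<^bsub>S\<^esub> (?c x)"
        using S.inv_equality[of "?c (inv\<^bsub>S\<^esub> x)" "?c x"] x(4) ix by (simp add: source_single)
      then show "inv\<^bsub>S\<^esub> x \<in> src (g # w)"
        using ix subgroup.m_inv_closed[OF IH(1) x(2)] unfolding source_Cons[of L _ g w] by simp
    next
      fix x y assume "x \<in> src (g # w)" "y \<in> src (g # w)"
      then show "x \<otimes>\<^bsub>S\<^esub> y \<in> src (g # w)"
        using source_mult[OF g, of x y] subgroup.m_closed[OF IH(1)]
        unfolding source_Cons[of L _ g w] by auto
    qed
    moreover have "conj_along L (g # w) (x \<otimes>\<^bsub>S\<^esub> y) = conj_along L (g # w) x \<otimes>\<^bsub>S\<^esub> conj_along L (g # w) y"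
      if "x \<in> src (g # w)" "y \<in> src (g # w)" for x y
      using that source_mult(2)[OF g, of x y] IH(2) unfolding source_Cons[of L _ g w] by auto
    ultimately show ?case by blast
  qed
  then show "set w \<subseteq> carrier L \<Longrightarrow> subgroup (src w) S"
    "\<lbrakk>set w \<subseteq> carrier L; x \<in> src w; y \<in> src w\<rbrakk> \<Longrightarrow>
      conj_along L w (x \<otimes>\<^bsub>S\<^esub> y) = conj_along L w x \<otimes>\<^bsub>S\<^esub> conj_along L w y" by blast+
qed

lemma source_in_objects: "w \<in> pg_words L \<Longrightarrow> src w \<in> \<Delta>"
  using word_iff_object[of w] objects_overgroup source_subgroup by blast

lemma source_prod:
  assumes "w \<in> pg_words L" "x \<in> src w"
  shows "x \<in> src [pg_prod L w]" "pg_conj L (pg_prod L w) x = conj_along L w x"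
proof -
  have "x \<in> pg_conj_dom L (pg_prod L w)" and eq: "pg_conj L (pg_prod L w) x = conj_along L w x"
    using conj_normalizer[OF source_in_objects[OF assms(1)] subset_refl word_closed[OF assms(1)]]
      object_in_normalizer[OF source_in_objects[OF assms(1)]] assms(2) by blast+
  then show "x \<in> src [pg_prod L w]"
    using subsetD[OF source_subset assms(2)] conj_along_in_target[OF assms(2)] by (auto simp: source_single)
  show "pg_conj L (pg_prod L w) x = conj_along L w x" by (rule eq)
qed

section \<open>Normalizers and centralizers\<close>

lemma normalizer_source_iff:
  assumes "Q \<subseteq> carrier S"
  shows "g \<in> pg_normalizer L Q \<longleftrightarrow> g \<in> carrier L \<and> Q \<subseteq> src [g] \<and> pg_conj L g ` Q = Q"
proof -
  have "Q \<subseteq> src [g] \<longleftrightarrow> Q \<subseteq> pg_conj_dom L g" if "pg_conj L g ` Q = Q"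
  proof -
    have "pg_conj L g x \<in> carrier S" if "x \<in> Q" for x
      using \<open>pg_conj L g ` Q = Q\<close> assms that by blast
    then show ?thesis
      using assms by (auto simp: source_single)
  qed
  then show ?thesis
    by (auto simp: pg_normalizer_def)
qed

lemma centralizer_source_iff:
  assumes "Q \<subseteq> carrier S"
  shows "g \<in> pg_centralizer L Q \<longleftrightarrow> g \<in> carrier L \<and> Q \<subseteq> src [g] \<and> (\<forall>x\<in>Q. pg_conj L g x = x)"
  using assms by (auto simp: pg_centralizer_def source_single)

lemma conj_along_normalizing:
  assumes "Q \<subseteq> carrier S" "set w \<subseteq> pg_normalizer L Q"
  shows "Q \<subseteq> src w" "conj_along L w ` Q = Q"
proof -
  have "Q \<subseteq> src w \<and> conj_along L w ` Q = Q"
    using assms(2)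
  proof (induction w)
    case (Cons g w)
    then have g: "Q \<subseteq> src [g]" "pg_conj L g ` Q = Q"
      using normalizer_source_iff[OF assms(1)] by auto
    have "conj_along L (g # w) = conj_along L w \<circ> pg_conj L g"
      by (rule ext) simp
    then have "conj_along L (g # w) ` Q = conj_along L w ` Q"
      using g(2) by (metis image_comp)
    moreover have "x \<in> src [g] \<and> pg_conj L g x \<in> src w" if "x \<in> Q" for x
      using that g Cons by (metis image_eqI list.set_intros(2) set_ConsD subset_iff)
    ultimately show ?case
      using Cons g(2) by (auto simp: source_Cons[of L _ g w])
  qed (use assms(1) in \<open>simp add: source_Nil\<close>)
  then show "Q \<subseteq> src w" "conj_along L w ` Q = Q" by auto
qed

lemma conj_along_centralizing:
  assumes "Q \<subseteq> carrier S" "set w \<subseteq> pg_centralizer L Q" "x \<in> Q"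
  shows "x \<in> src w" "conj_along L w x = x"
proof -
  have "x \<in> src w \<and> conj_along L w x = x"
    using assms(2)
  proof (induction w)
    case (Cons g w)
    then have "x \<in> src [g]" "pg_conj L g x = x"
      using centralizer_source_iff[OF assms(1)] assms(3) by auto
    with Cons show ?case
      by (auto simp: source_Cons[of L _ g w])
  qed (use assms in \<open>auto simp: source_Nil\<close>)
  then show "x \<in> src w" "conj_along L w x = x" by auto
qed

text \<open>
  If all letters of a word normalize \<open>Q\<close>, then \<open>Q\<close> stays in \<open>S\<close> along the word, so conjugation by the
  product is the composite of the conjugations by the letters also on \<open>Q\<close>.
\<close>

lemma normalizer_partial_subgroup:
  assumes Q: "Q \<subseteq> carrier S"
  shows "partial_subgroup L (pg_normalizer L Q)"
  unfolding partial_subgroup_def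
proof (intro conjI ballI)
  fix w assume w: "w \<in> pg_words L \<inter> lists (pg_normalizer L Q)"
  then have "Q \<subseteq> src w" "conj_along L w ` Q = Q"
    using conj_along_normalizing[OF Q, of w] by auto
  moreover have "pg_conj L (pg_prod L w) ` Q = conj_along L w ` Q"
    using w \<open>Q \<subseteq> src w\<close> source_prod(2)[of w] by (intro image_cong) auto
  ultimately show "pg_prod L w \<in> pg_normalizer L Q"
    using w source_prod(1)[of w] prod_closed by (auto simp: normalizer_source_iff[OF Q])
qed (auto simp: normalizer_inv, simp add: pg_normalizer_def)

lemma centralizer_partial_subgroup:
  assumes Q: "Q \<subseteq> carrier S"
  shows "partial_subgroup L (pg_centralizer L Q)"
  unfolding partial_subgroup_def
proof (intro conjI ballI)
  fix w assume w: "w \<in> pg_words L \<inter> lists (pg_centralizer L Q)"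
  then have "x \<in> src w \<and> conj_along L w x = x" if "x \<in> Q" for x
    using conj_along_centralizing[OF Q, of w x] that by auto
  then show "pg_prod L w \<in> pg_centralizer L Q"
    using w source_prod[of w] prod_closed by (auto simp: centralizer_source_iff[OF Q])
qed (auto simp: centralizer_inv, simp add: pg_centralizer_def)

text \<open>
  Every word in the normalizer of an object \<open>P\<close> can be multiplied via \<open>P\<close>.
\<close>

lemma normalizer_subgroup:
  assumes P: "P \<in> \<Delta>"
  shows "pg_subgroup L (pg_normalizer L P)"
  unfolding pg_subgroup_def
proof (rule conjI, rule normalizer_partial_subgroup[OF objects_subset[OF P]], rule subsetI)
  fix w assume w: "w \<in> lists (pg_normalizer L P)"
  then have "set w \<subseteq> pg_normalizer L P" by auto
  moreover then have "set w \<subseteq> carrier L" by (auto simp: pg_normalizer_def)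
  ultimately show "w \<in> pg_words L"
    using wordI[OF _ P] conj_along_normalizing(1)[OF objects_subset[OF P]] by blast
qed

abbreviation normalizer_group :: "'a set \<Rightarrow> 'a monoid" where
  "normalizer_group P \<equiv> pg_induced_group L (pg_normalizer L P)"

lemma normalizer_group_simps:
  assumes "P \<in> \<Delta>"
  shows "group (normalizer_group P)" "finite (carrier (normalizer_group P))"
    "carrier (normalizer_group P) = pg_normalizer L P"
    "subgroup K (normalizer_group P) \<longleftrightarrow> pg_subgroup L K \<and> K \<subseteq> pg_normalizer L P"
proof -
  show "group (normalizer_group P)" "carrier (normalizer_group P) = pg_normalizer L P"
    "subgroup K (normalizer_group P) \<longleftrightarrow> pg_subgroup L K \<and> K \<subseteq> pg_normalizer L P"
    using group_induced(1)[OF normalizer_subgroup[OF assms]]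
      subgroup_induced_iff[OF normalizer_subgroup[OF assms]] by (auto simp: pg_induced_group_def)
  show "finite (carrier (normalizer_group P))"
    using finite_carrier by (rule finite_subset[rotated]) (auto simp: pg_normalizer_def pg_induced_group_def)
qed

lemma finite_pg_subgroup: "pg_subgroup L H \<Longrightarrow> finite H"
  using finite_carrier finite_subset by (auto simp: pg_subgroup_def partial_subgroup_def)

lemma card_p_subgroup:
  assumes "pg_subgroup L H" "card H = p ^ n" "pg_subgroup L K" "K \<subseteq> H"
  shows "\<exists>m. card K = p ^ m"
proof -
  have "card K dvd order (pg_induced_group L H)"
    using group.lagrange[OF group_induced(1)[OF assms(1)], of K] subgroup_induced_iff[OF assms(1)] assms
    by (metis dvd_triv_right)
  then have "card K dvd p ^ n"
    using assms(2) by (simp add: order_def pg_induced_group_def)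
  then show ?thesis
    using divides_primepow_nat[OF prime_p] by blast
qed

lemma card_S: "\<exists>n. card (carrier S) = p ^ n"
  using S_p_subgroup by (simp add: pg_p_subgroup_def finite_p_group_def order_def pg_induced_group_def)

lemma S_maximal_p_subgroup:
  assumes "pg_subgroup L H" "card H = p ^ n" "carrier S \<subseteq> H"
  shows "H = carrier S"
proof -
  have "finite H"
    using finite_pg_subgroup[OF assms(1)] .
  then show ?thesis
    using S_maximal[of H] assms group_induced(1)[OF assms(1)]
    by (auto simp: pg_p_subgroup_def finite_p_group_def order_def pg_induced_group_def)
qed

lemma conj_compose:
  assumes P: "P \<in> \<Delta>" "P \<subseteq> src [k]" "pg_conj L k ` P \<subseteq> src [h]" and L: "k \<in> carrier L" "h \<in> carrier L"
  shows "[k, h] \<in> pg_words L" "P \<subseteq> src [pg_prod L [k, h]]"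
    "x \<in> pg_normalizer L P \<Longrightarrow> pg_conj L (pg_prod L [k, h]) x = pg_conj L h (pg_conj L k x)"
proof -
  have src: "P \<subseteq> src [k, h]"
    using P by (auto simp: source_Cons[of L _ k "[h]"])
  then show w: "[k, h] \<in> pg_words L"
    using wordI[OF _ P(1)] L by simp
  show "P \<subseteq> src [pg_prod L [k, h]]"
    using src source_prod(1)[OF w] by blast
  show "x \<in> pg_normalizer L P \<Longrightarrow> pg_conj L (pg_prod L [k, h]) x = pg_conj L h (pg_conj L k x)"
    using conj_normalizer(2)[OF P(1) src] L by simp
qed

text \<open>
  If \<open>P\<^sup>h\<close> lies in \<open>S\<close>, conjugation by \<open>h\<close> is an injective homomorphism between the groups \<open>N(P)\<close> and
  \<open>N(P\<^sup>h)\<close>, although these may contain elements outside \<open>S\<close>.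
\<close>

lemma conj_normalizer_group:
  assumes P: "P \<in> \<Delta>" "P \<subseteq> src [h]" and h: "h \<in> carrier L"
  shows "pg_conj L h ` P \<in> \<Delta>"
    "x \<in> pg_normalizer L P \<Longrightarrow> x \<in> pg_conj_dom L h"
    "x \<in> pg_normalizer L P \<Longrightarrow> pg_conj L h x \<in> pg_normalizer L (pg_conj L h ` P)"
    "\<lbrakk>x \<in> pg_normalizer L P; y \<in> pg_normalizer L P\<rbrakk> \<Longrightarrow>
      pg_conj L h (pg_prod L [x, y]) = pg_prod L [pg_conj L h x, pg_conj L h y]"
proof -
  let ?Ph = "pg_conj L h ` P"
  show Ph: "?Ph \<in> \<Delta>"
    using object_conj_along[OF P] h by simp
  show dom: "x \<in> pg_conj_dom L h" if "x \<in> pg_normalizer L P" for x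
    using conj_normalizer(1)[OF P _ that] h prod_singleton[OF h] by simp
  have word: "?Ph \<subseteq> src [pg_inv L h, x, h] \<and> [pg_inv L h, x, h] \<in> pg_words L \<and>
      (\<forall>z\<in>P. conj_along L [pg_inv L h, x, h] (pg_conj L h z) = pg_conj L h (pg_conj L x z))"
    if x: "x \<in> pg_normalizer L P" for x
  proof -
    have x': "x \<in> carrier L" "P \<subseteq> src [x]" "pg_conj L x ` P = P"
      using x normalizer_source_iff[OF objects_subset[OF P(1)]] by auto
    have "pg_conj L h z \<in> src [pg_inv L h, x, h] \<and>
        conj_along L [pg_inv L h, x, h] (pg_conj L h z) = pg_conj L h (pg_conj L x z)" if z: "z \<in> P" for z
    proof -
      have "z \<in> src [h]" "z \<in> src [x]" "pg_conj L x z \<in> src [h]"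
        using z P x' by auto
      then show ?thesis
        using conj_back(1,2)[OF _ h, of z] by (simp add: source_def)
    qed
    moreover then have "?Ph \<subseteq> src [pg_inv L h, x, h]" by blast
    moreover then have "[pg_inv L h, x, h] \<in> pg_words L"
      using wordI[OF _ Ph] h x' inv_closed by auto
    ultimately show ?thesis by blast
  qed
  have conj: "pg_conj L (pg_conj L h x) (pg_conj L h z) = pg_conj L h (pg_conj L x z)"
    if x: "x \<in> pg_normalizer L P" and z: "z \<in> P" for x z
    using source_prod(2)[of "[pg_inv L h, x, h]" "pg_conj L h z"] word[OF x] z
    by (auto simp: pg_conj_def[of L h x])
  show norm: "pg_conj L h x \<in> pg_normalizer L ?Ph" if x: "x \<in> pg_normalizer L P" for x
  proof -
    have "pg_conj L (pg_conj L h x) ` ?Ph = (\<lambda>z. pg_conj L h (pg_conj L x z)) ` P"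
      unfolding image_image using conj[OF x] by (rule image_cong[OF refl])
    also have "\<dots> = pg_conj L h ` pg_conj L x ` P"
      by (simp add: image_image)
    also have "\<dots> = ?Ph"
      using x by (simp add: pg_normalizer_def)
    finally have eq: "pg_conj L (pg_conj L h x) ` ?Ph = ?Ph" .
    have "?Ph \<subseteq> src [pg_conj L h x]" "pg_conj L h x \<in> carrier L"
      using source_prod(1)[of "[pg_inv L h, x, h]"] word[OF x] prod_closed[of "[pg_inv L h, x, h]"]
      by (auto simp: pg_conj_def[of L h x])
    then show ?thesis
      using eq normalizer_source_iff[OF objects_subset[OF Ph]] by blast
  qed
  show "pg_conj L h (pg_prod L [x, y]) = pg_prod L [pg_conj L h x, pg_conj L h y]"
    if x: "x \<in> pg_normalizer L P" and y: "y \<in> pg_normalizer L P"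
  proof -
    let ?u = "[pg_inv L h, x, h]" and ?v = "[pg_inv L h, y, h]"
    have "?Ph \<subseteq> src (?u @ ?v)"
    proof
      fix t assume t: "t \<in> ?Ph"
      then obtain z where z: "z \<in> P" "t = pg_conj L h z" by blast
      then have "conj_along L ?u t = pg_conj L h (pg_conj L x z)" "pg_conj L x z \<in> P"
        using word[OF x] x by (auto simp: pg_normalizer_def)
      then have "conj_along L ?u t \<in> ?Ph" by simp
      then show "t \<in> src (?u @ ?v)"
        unfolding source_append using t word[OF x] word[OF y] by blast
    qed
    moreover have "set (?u @ ?v) \<subseteq> carrier L"
      using h inv_closed x y by (auto simp: pg_normalizer_def)
    ultimately have w: "?u @ ?v \<in> pg_words L"
      using wordI Ph by blast
    have "pg_prod L [pg_conj L h x, pg_conj L h y] = pg_prod L (?u @ ?v)"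
      using prod_append(2)[OF w] by (simp add: pg_conj_def)
    also have "\<dots> = pg_prod L [pg_inv L h, x, y, h]"
      using cancel_inv_right(2)[of "[pg_inv L h, x]" h "[y, h]"] w by simp
    also have "\<dots> = pg_prod L [pg_inv L h, pg_prod L [x, y], h]"
      using prod_assoc[of "[pg_inv L h]" "[x, y]" "[h]"] cancel_inv_right(1)[of "[pg_inv L h, x]" h "[y, h]"] w
      by simp
    finally show ?thesis by (simp add: pg_conj_def)
  qed
qed

lemma conj_subgroup_of_normalizer:
  assumes P: "P \<in> \<Delta>" "P \<subseteq> src [h]" and h: "h \<in> carrier L"
    and R: "pg_subgroup L R" "R \<subseteq> pg_normalizer L P"
  shows "pg_subgroup L (pg_conj L h ` R)" "pg_conj L h ` R \<subseteq> pg_normalizer L (pg_conj L h ` P)"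
    "card (pg_conj L h ` R) = card R"
proof -
  note c = conj_normalizer_group[OF P h]
  have "pg_conj L h \<in> hom (normalizer_group P) (normalizer_group (pg_conj L h ` P))"
    using c(3,4) by (auto simp: hom_def pg_induced_group_def)
  then have "group_hom (normalizer_group P) (normalizer_group (pg_conj L h ` P)) (pg_conj L h)"
    using normalizer_group_simps(1)[OF P(1)] normalizer_group_simps(1)[OF c(1)]
    by (simp add: group_hom_def group_hom_axioms_def)
  then have "subgroup (pg_conj L h ` R) (normalizer_group (pg_conj L h ` P))"
    using group_hom.subgroup_img_is_subgroup normalizer_group_simps(4)[OF P(1)] R by blast
  then show "pg_subgroup L (pg_conj L h ` R)" "pg_conj L h ` R \<subseteq> pg_normalizer L (pg_conj L h ` P)"
    using normalizer_group_simps(4)[OF c(1)] by auto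
  show "card (pg_conj L h ` R) = card R"
    using c(2) R(2) by (intro card_image inj_on_conj[OF h]) auto
qed

lemma normalizer_group_conj:
  assumes P: "P \<in> \<Delta>" and "x \<in> pg_normalizer L P" "g \<in> pg_normalizer L P"
  shows "pg_conj L g x = inv\<^bsub>normalizer_group P\<^esub> g \<otimes>\<^bsub>normalizer_group P\<^esub> x \<otimes>\<^bsub>normalizer_group P\<^esub> g"
  using induced_conj(2)[OF normalizer_subgroup[OF P]] assms by blast

section \<open>Conjugating p-subgroups into S\<close>

lemma normalizer_in_S_grows:
  assumes P: "P \<in> \<Delta>" "P \<noteq> carrier S"
  shows "P \<subset> pg_normalizer L P \<inter> carrier S"
proof -
  have sub: "subgroup P S" using objects_subgroups[OF P(1)] .
  obtain n where n: "card (carrier S) = p ^ n" using card_S by blast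
  obtain x where x: "x \<in> carrier S - P" "\<forall>k\<in>P. x \<otimes>\<^bsub>S\<^esub> k \<otimes>\<^bsub>S\<^esub> inv\<^bsub>S\<^esub> x \<in> P"
    using S.p_subgroup_normalizer_grows[OF prime_p finite_S S.subgroup_self n sub] P objects_subset
    by blast
  let ?y = "inv\<^bsub>S\<^esub> x"
  have y: "?y \<in> carrier S" "?y \<notin> P"
    using x subgroup.m_inv_closed[OF sub, of ?y] by auto
  have into: "pg_conj L ?y ` P \<subseteq> P"
    using x S_conj(2)[OF _ y(1)] subgroup.mem_carrier[OF sub] by auto
  have dom: "P \<subseteq> pg_conj_dom L ?y"
    using S_conj(1)[OF _ y(1)] subgroup.mem_carrier[OF sub] by blast
  have "inj_on (pg_conj L ?y) P"
    using inj_on_conj[OF _ dom] y(1) S_closed by blast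
  then have "pg_conj L ?y ` P = P"
    using into finite_subset[OF objects_subset[OF P(1)] finite_S] by (metis endo_inj_surj)
  then have "?y \<in> pg_normalizer L P"
    using dom y S_closed by (auto simp: pg_normalizer_def)
  then show ?thesis
    using object_in_normalizer[OF P(1)] objects_subset[OF P(1)] y by blast
qed

lemma normalizer_in_S_object:
  assumes P: "P \<in> \<Delta>"
  shows "pg_normalizer L P \<inter> carrier S \<in> \<Delta>"
    "pg_subgroup L (pg_normalizer L P \<inter> carrier S)"
    "\<exists>n. card (pg_normalizer L P \<inter> carrier S) = p ^ n"
proof -
  show sub: "pg_subgroup L (pg_normalizer L P \<inter> carrier S)"
    using pg_subgroup_Int[OF normalizer_subgroup[OF P] S_subgroup] .
  show "pg_normalizer L P \<inter> carrier S \<in> \<Delta>"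
    using objects_overgroup[OF P] subgroup_S_iff sub object_in_normalizer[OF P] objects_subset[OF P]
    by simp
  show "\<exists>n. card (pg_normalizer L P \<inter> carrier S) = p ^ n"
    using card_p_subgroup[OF S_subgroup _ sub] card_S by blast
qed

text \<open>
  Induction on \<open>T = N\<^sub>S(P)\<close>, from large to small. Inside the group \<open>N(P)\<close>, conjugate \<open>R\<close> into a Sylow
  \<open>p\<close>-subgroup \<open>R'\<close> that contains \<open>T\<close>. If \<open>R'\<close> is larger than \<open>T\<close>, then so is \<open>R\<^sub>1 = N\<^sub>R\<^sub>'(T)\<close>. The object \<open>T\<close> has a
  larger normalizer in \<open>S\<close> than \<open>P\<close> does, so induction yields \<open>h\<close> that conjugates \<open>R\<^sub>1\<close> into \<open>S\<close>. Now \<open>P\<^sup>h\<close>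
  is normalized by the subgroup \<open>R\<^sub>1\<^sup>h\<close> of \<open>S\<close>, and induction applies to \<open>P\<^sup>h\<close> and \<open>R'\<^sup>h\<close>.
\<close>

lemma p_subgroup_of_normalizer_conj_into_S:
  assumes "P \<in> \<Delta>" "pg_subgroup L R" "card R = p ^ n" "R \<subseteq> pg_normalizer L P"
  shows "\<exists>h\<in>carrier L. P \<subseteq> src [h] \<and> pg_conj L h ` R \<subseteq> carrier S"
  using assms
proof (induction "card (carrier S) - card (pg_normalizer L P \<inter> carrier S)" arbitrary: P R n rule: less_induct)
  case less
  note P = \<open>P \<in> \<Delta>\<close>
  let ?G = "normalizer_group P" and ?T = "pg_normalizer L P \<inter> carrier S"
  interpret G: group ?G using normalizer_group_simps(1)[OF P] .
  note G = normalizer_group_simps(2,3)[OF P] and sub_G = normalizer_group_simps(4)[OF P]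
  note T = normalizer_in_S_object[OF P]
  have smaller: "card (carrier S) - card X < card (carrier S) - card ?T"
    if "card ?T < card X" "X \<subseteq> carrier S" for X
    using that card_mono[OF finite_S that(2)] by linarith
  obtain R' where R': "sylow_subgroup p ?G R'" "?T \<subseteq> R'"
    using G.p_subgroup_in_sylow[OF prime_p G(1)] T sub_G by (metis inf_le1)
  then obtain m where subR': "pg_subgroup L R'" "R' \<subseteq> pg_normalizer L P" "card R' = p ^ m"
    using sub_G by (auto simp: sylow_subgroup_def)
  obtain k where k: "k \<in> pg_normalizer L P" "(\<lambda>x. inv\<^bsub>?G\<^esub> k \<otimes>\<^bsub>?G\<^esub> x \<otimes>\<^bsub>?G\<^esub> k) ` R \<subseteq> R'"
    using G.p_subgroup_conj_into_sylow[OF prime_p G(1), of R n R'] less.prems sub_G R'(1) G(2)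
    by (auto simp: sylow_subgroup_def)
  have kR: "pg_conj L k ` R \<subseteq> R'"
    using k(2) less.prems(4) normalizer_group_conj[OF P _ k(1)] by (auto simp: subset_iff)
  have kL: "k \<in> carrier L" "P \<subseteq> src [k]" "pg_conj L k ` P = P"
    using k(1) normalizer_source_iff[OF objects_subset[OF P]] by auto
  show ?case
  proof (cases "R' = ?T")
    case True
    then show ?thesis using kL kR by blast
  next
    case False
    then have TR': "?T \<subset> R'" using R'(2) by blast
    \<comment> \<open>Otherwise \<open>R'\<close> would be a \<open>p\<close>-subgroup properly containing \<open>S\<close>.\<close>
    have T_S: "?T \<noteq> carrier S"
      using S_maximal_p_subgroup[OF subR'(1,3)] TR' by blast
    let ?R1 = "R' \<inter> pg_normalizer L ?T"
    have R1: "pg_subgroup L ?R1" "\<exists>l. card ?R1 = p ^ l"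
      using pg_subgroup_Int[OF subR'(1) normalizer_subgroup[OF T(1)]] card_p_subgroup[OF subR'(1,3)]
      by auto
    have "?T \<subset> ?R1"
    proof -
      have subT: "subgroup ?T ?G" using T(2) sub_G by simp
      obtain x where x: "x \<in> R' - ?T" "\<forall>t\<in>?T. x \<otimes>\<^bsub>?G\<^esub> t \<otimes>\<^bsub>?G\<^esub> inv\<^bsub>?G\<^esub> x \<in> ?T"
        using G.p_subgroup_normalizer_grows[OF prime_p G(1) _ subR'(3) subT TR'] sub_G subR' by blast
      have xG: "x \<in> carrier ?G" using x(1) subR'(2) G(2) by blast
      let ?y = "inv\<^bsub>?G\<^esub> x"
      have y: "?y \<in> R'" "?y \<notin> ?T" "?y \<in> pg_normalizer L P"
        using x(1) xG subgroup.m_inv_closed[of R' ?G x] subgroup.m_inv_closed[OF subT, of ?y] subR' sub_G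
        by auto
      have into: "pg_conj L ?y ` ?T \<subseteq> ?T"
        using x(2) normalizer_group_conj[OF P _ y(3)] xG by auto
      have dom: "?T \<subseteq> pg_conj_dom L ?y"
        using induced_conj(1)[OF normalizer_subgroup[OF P] _ y(3)] by blast
      have yL: "?y \<in> carrier L" using y(3) by (simp add: pg_normalizer_def)
      have "pg_conj L ?y ` ?T = ?T"
        using into inj_on_conj[OF yL dom] finite_subset[OF _ finite_S, of ?T] by (metis endo_inj_surj inf_le2)
      then have "?y \<in> pg_normalizer L ?T"
        using dom yL by (simp add: pg_normalizer_def)
      then show ?thesis
        using y R'(2) object_in_normalizer[OF T(1)] by blast
    qed
    moreover have finR1: "finite ?R1"
      using finite_pg_subgroup[OF R1(1)] .
    ultimately have cR1: "card ?T < card ?R1"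
      by (rule psubset_card_mono[rotated])
    have "card ?T < card (pg_normalizer L ?T \<inter> carrier S)"
      using normalizer_in_S_grows[OF T(1) T_S] finite_S by (intro psubset_card_mono) auto
    then obtain h where h: "h \<in> carrier L" "?T \<subseteq> src [h]" "pg_conj L h ` ?R1 \<subseteq> carrier S"
      using less.hyps[OF smaller T(1) R1(1)] R1(2) by blast
    have Ph: "P \<subseteq> src [h]"
      using h(2) object_in_normalizer[OF P] objects_subset[OF P] by blast
    note c = conj_normalizer_group[OF P Ph h(1)]
    note cR' = conj_subgroup_of_normalizer[OF P Ph h(1) subR'(1,2)]
    let ?Ph = "pg_conj L h ` P"
    have "pg_conj L h ` ?R1 \<subseteq> pg_normalizer L ?Ph \<inter> carrier S"
      using cR'(2) h(3) by blast
    moreover have "card (pg_conj L h ` ?R1) = card ?R1"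
      using c(2) subR'(2) by (intro card_image inj_on_conj[OF h(1)]) auto
    ultimately have "card ?T < card (pg_normalizer L ?Ph \<inter> carrier S)"
      using cR1 card_mono[of "pg_normalizer L ?Ph \<inter> carrier S" "pg_conj L h ` ?R1"] finite_S by auto
    then obtain h' where h': "h' \<in> carrier L" "?Ph \<subseteq> src [h']" "pg_conj L h' ` pg_conj L h ` R' \<subseteq> carrier S"
      using less.hyps[OF smaller c(1) cR'(1) trans[OF cR'(3) subR'(3)] cR'(2)] by blast
    let ?m = "pg_prod L [h, h']"
    note m = conj_compose[OF P Ph h'(2) h(1) h'(1)]
    have mL: "?m \<in> carrier L" using prod_closed[OF m(1)] .
    have mR': "pg_conj L ?m x \<in> carrier S" if "x \<in> R'" for x
      using m(3)[of x] that subR'(2) h'(3) by auto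
    have "pg_conj L k ` P \<subseteq> src [?m]" using kL(3) m(2) by simp
    note q = conj_compose[OF P kL(2) this kL(1) mL]
    have "pg_conj L (pg_prod L [k, ?m]) ` R \<subseteq> carrier S"
      using q(3) less.prems(4) mR' kR by (auto simp: subset_iff image_subset_iff)
    then show ?thesis
      using q(2) prod_closed[OF q(1)] by blast
  qed
qed

section \<open>Partial subgroups that realize the conjugation maps\<close>

text \<open>
  Objective characteristic \<open>p\<close> enters exactly once: an element centralizing \<open>P\<close> lies in \<open>P\<close> if \<open>P\<close> is the largest normal
  \<open>p\<close>-subgroup of its normalizer. In all other cases the induction is carried by objects larger
  than \<open>P\<close>.
\<close>

theorem partial_subgroup_realizing_fusion_is_everything:
  assumes ochar: "objective_characteristic p L \<Delta>"
    and M: "partial_subgroup L M" and S_M: "carrier S \<subseteq> M"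
    and real: "\<And>P g. \<lbrakk>P \<in> \<Delta>; g \<in> carrier L; P \<subseteq> src [g]\<rbrakk> \<Longrightarrow>
      \<exists>f\<in>M. P \<subseteq> src [f] \<and> (\<forall>x\<in>P. pg_conj L f x = pg_conj L g x)"
  shows "carrier L = M"
proof -
  have M_closed: "pg_prod L w \<in> M" if "w \<in> pg_words L" "set w \<subseteq> M" for w
    using M that by (auto simp: partial_subgroup_def in_lists_conv_set subset_iff)
  have M_sub: "M \<subseteq> carrier L" and M_inv: "x \<in> M \<Longrightarrow> pg_inv L x \<in> M" for x
    using M by (auto simp: partial_subgroup_def)
  have all_in: "g \<in> M" if "P \<in> \<Delta>" "g \<in> carrier L" "P \<subseteq> src [g]" for P g
    using that
  proof (induction "card (carrier S) - card P" arbitrary: P g rule: less_induct)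
    case less
    note P = \<open>P \<in> \<Delta>\<close> and PS = objects_subset[OF \<open>P \<in> \<Delta>\<close>]
    have larger: "g' \<in> M"
      if "card P < card P'" "P' \<in> \<Delta>" "g' \<in> carrier L" "P' \<subseteq> src [g']" for P' g'
      using that less.hyps[of P' g'] card_mono[OF finite_S objects_subset[OF that(2)]] by linarith
    obtain f where f: "f \<in> M" "P \<subseteq> src [f]" "\<And>x. x \<in> P \<Longrightarrow> pg_conj L f x = pg_conj L g x"
      using real[OF less.prems] by blast
    have fL: "f \<in> carrier L" "pg_inv L f \<in> carrier L" using f(1) M_sub inv_closed by auto
    \<comment> \<open>Since \<open>g\<close> is the product of \<open>(c, f)\<close>, it suffices to treat \<open>c\<close>, which centralizes \<open>P\<close>.\<close>
    let ?c = "pg_prod L [g, pg_inv L f]"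
    have back_f: "pg_conj L g x \<in> src [pg_inv L f]" "pg_conj L (pg_inv L f) (pg_conj L g x) = x"
      if "x \<in> P" for x
      using conj_back(1,2)[OF _ fL(1), of x] f(2,3) less.prems(3) that PS
      by (auto simp: source_single subset_iff)
    have "pg_conj L g ` P \<subseteq> src [pg_inv L f]"
      using back_f(1) by blast
    note cmp = conj_compose[OF P less.prems(3) this less.prems(2) fL(2)]
    have cL: "?c \<in> carrier L" using prod_closed[OF cmp(1)] .
    have c_fix: "pg_conj L ?c x = x" if "x \<in> P" for x
      using cmp(3)[of x] object_in_normalizer[OF P] that back_f(2) by auto
    have c_norm: "?c \<in> pg_normalizer L P"
      using normalizer_source_iff[OF PS] cL cmp(2) c_fix by simp
    have "?c \<in> M"
    proof -
      let ?G = "normalizer_group P" and ?T = "pg_normalizer L P \<inter> carrier S"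
      interpret G: group ?G using normalizer_group_simps(1)[OF P] .
      note G = normalizer_group_simps(2,3)[OF P] and sub_G = normalizer_group_simps(4)[OF P]
      define V where "V = p_core p ?G"
      have V: "V \<lhd> ?G" "\<exists>n. card V = p ^ n" "\<And>N n. \<lbrakk>N \<lhd> ?G; card N = p ^ n\<rbrakk> \<Longrightarrow> N \<subseteq> V"
        using G.p_core_is_largest[OF prime_p G(1)] unfolding V_def by blast+
      have subV: "pg_subgroup L V" "V \<subseteq> pg_normalizer L P"
        using normal_imp_subgroup[OF V(1)] sub_G by auto
      have finV: "finite V" using finite_pg_subgroup[OF subV(1)] .
      have subP: "pg_subgroup L P" "subgroup P ?G"
        using objects_subgroups[OF P] subgroup_S_iff sub_G object_in_normalizer[OF P] by auto
      have "P \<lhd> ?G"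
        unfolding G.normal_inv_iff
      proof (intro conjI subP ballI)
        fix x z assume x: "x \<in> carrier ?G" and z: "z \<in> P"
        then have "pg_conj L (inv\<^bsub>?G\<^esub> x) z = x \<otimes>\<^bsub>?G\<^esub> z \<otimes>\<^bsub>?G\<^esub> inv\<^bsub>?G\<^esub> x"
          using normalizer_group_conj[OF P, of z "inv\<^bsub>?G\<^esub> x"] object_in_normalizer[OF P] G.inv_closed[OF x] G(2)
          by auto
        moreover have "pg_conj L (inv\<^bsub>?G\<^esub> x) z \<in> P"
          using G.inv_closed[OF x] G(2) z by (auto simp: pg_normalizer_def)
        ultimately show "x \<otimes>\<^bsub>?G\<^esub> z \<otimes>\<^bsub>?G\<^esub> inv\<^bsub>?G\<^esub> x \<in> P" by simp
      qed
      then have PV: "P \<subseteq> V"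
        using V(3) card_p_subgroup[OF S_subgroup _ subP(1) PS] card_S by blast
      show ?thesis
      proof (cases "V = P")
        case True
        have "?c \<in> group_centralizer ?G P"
          unfolding group_centralizer_def
        proof (intro CollectI conjI ballI)
          show "?c \<in> carrier ?G" using c_norm G(2) by simp
          fix x assume x: "x \<in> P"
          then have "x \<in> pg_conj_dom L ?c"
            using cmp(2) by (auto simp: source_single)
          then show "?c \<otimes>\<^bsub>?G\<^esub> x = x \<otimes>\<^bsub>?G\<^esub> ?c"
            using conj_back(5)[OF _ cL, of x] c_fix[OF x] by (simp add: pg_induced_group_def)
        qed
        moreover have "group_centralizer ?G V \<subseteq> V"
          using ochar P unfolding objective_characteristic_def of_characteristic_def V_def by blast
        ultimately have "?c \<in> P" using True by blast
        then show ?thesis using PS S_M by blast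
      next
        case False
        then have cV: "card P < card V"
          using PV finV by (intro psubset_card_mono) auto
        \<comment> \<open>The maximality of \<open>S\<close> excludes a larger \<open>p\<close>-subgroup \<open>V\<close>.\<close>
        have PnS: "P \<noteq> carrier S"
          using S_maximal_p_subgroup[OF subV(1)] V(2) PV False by blast
        note T = normalizer_in_S_object[OF P]
        obtain R where R: "sylow_subgroup p ?G R" "?T \<subseteq> R"
          using G.p_subgroup_in_sylow[OF prime_p G(1)] T sub_G by (metis inf_le1)
        have VR: "V \<subseteq> R"
          using G.normal_p_subgroup_in_sylow[OF prime_p G(1) V(1) _ R(1)] V(2) by blast
        obtain h where h: "h \<in> carrier L" "P \<subseteq> src [h]" "pg_conj L h ` R \<subseteq> carrier S"
          using p_subgroup_of_normalizer_conj_into_S[OF P, of R] R(1) sub_G unfolding sylow_subgroup_def by blast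
        note c = conj_normalizer_group[OF P h(2,1)]
        let ?Vh = "pg_conj L h ` V" and ?ch = "pg_conj L h ?c"
        have hM: "h \<in> M"
        proof (rule larger[OF _ T(1) h(1)])
          show "card P < card ?T"
            using normalizer_in_S_grows[OF P PnS] finite_S by (intro psubset_card_mono) auto
          show "?T \<subseteq> src [h]"
            using R(2) h(3) c(2) by (auto simp: source_single image_subset_iff)
        qed
        have "?ch \<in> M"
        proof (rule larger)
          \<comment> \<open>As \<open>V\<close> is normal in the normalizer of \<open>P\<close>, the conjugate of \<open>c\<close> by \<open>h\<close> normalizes that of \<open>V\<close>.\<close>
          note cV' = conj_subgroup_of_normalizer[OF P h(2,1) subV]
          show "card P < card ?Vh" using cV cV'(3) by simp
          have VhS: "?Vh \<subseteq> carrier S" using VR h(3) by blast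
          then have "subgroup ?Vh S" using cV'(1) subgroup_S_iff by simp
          then show VhD: "?Vh \<in> \<Delta>"
            using objects_overgroup[OF c(1)] PV by blast
          show "?ch \<in> carrier L" using c(3)[OF c_norm] by (simp add: pg_normalizer_def)
          show "?Vh \<subseteq> src [?ch]"
          proof
            fix y assume "y \<in> ?Vh"
            then obtain v where v: "v \<in> V" "y = pg_conj L h v" by blast
            then have vN: "v \<in> pg_normalizer L P" using subV(2) by blast
            let ?N = "pg_normalizer L (pg_conj L h ` P)"
            have yN: "y \<in> ?N" and chN: "?ch \<in> ?N" using c(3) vN v(2) c_norm by auto
            have dom: "y \<in> pg_conj_dom L ?ch"
              using induced_conj(1)[OF normalizer_subgroup[OF c(1)] yN chN] .
            \<comment> \<open>It is shown that \<open>y\<close> is sent to the conjugate of \<open>v'\<close> by \<open>h\<close>, which lies in \<open>S\<close>.\<close>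
            let ?v' = "pg_conj L ?c v"
            have v'V: "?v' \<in> V"
              using normal.inv_op_closed1[OF V(1) _ v(1)] normalizer_group_conj[OF P vN c_norm] c_norm G(2)
              by simp
            then have v'N: "?v' \<in> pg_normalizer L P" using subV(2) by blast
            have "v \<in> pg_conj_dom L ?c"
              using induced_conj(1)[OF normalizer_subgroup[OF P] vN c_norm] .
            then have "pg_prod L [?c, ?v'] = pg_prod L [v, ?c]"
              using conj_back(5)[OF _ cL] by blast
            then have "pg_prod L [?ch, pg_conj L h ?v'] = pg_prod L [y, ?ch]"
              using c(4)[OF c_norm v'N] c(4)[OF vN c_norm] v(2) by simp
            moreover have "pg_prod L [?ch, pg_conj L ?ch y] = pg_prod L [y, ?ch]"
              using conj_back(5)[OF dom] c(3)[OF c_norm] by (simp add: pg_normalizer_def)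
            ultimately have eq: "pg_prod L [?ch, pg_conj L h ?v'] = pg_prod L [?ch, pg_conj L ?ch y]"
              by simp
            interpret Gh: group "normalizer_group (pg_conj L h ` P)" using normalizer_group_simps(1)[OF c(1)] .
            have "pg_conj L ?ch y \<in> ?N"
              using normalizer_group_conj[OF c(1) yN chN] yN chN Gh.m_closed Gh.inv_closed
              by (simp add: normalizer_group_simps(3)[OF c(1)])
            then have "pg_conj L ?ch y = pg_conj L h ?v'"
              using Gh.Units_l_cancel[unfolded Gh.Units_eq, of ?ch "pg_conj L ?ch y" "pg_conj L h ?v'"] eq c(3)[OF v'N] chN
              by (simp add: pg_induced_group_def)
            then show "y \<in> src [?ch]"
              using dom VhS v'V v by (auto simp: source_single)
          qed
        qed
        have cdom: "?c \<in> pg_conj_dom L h" using c(2)[OF c_norm] .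
        have h_inv: "pg_inv L h \<in> M" using M_inv hM by blast
        have "pg_conj L (pg_inv L h) ?ch = ?c" "?ch \<in> pg_conj_dom L (pg_inv L h)"
          using conj_back(1,2)[OF cdom h(1)] by auto
        then have "pg_prod L [pg_inv L (pg_inv L h), ?ch, pg_inv L h] = ?c"
          "[pg_inv L (pg_inv L h), ?ch, pg_inv L h] \<in> pg_words L"
          by (auto simp: pg_conj_def pg_conj_dom_def)
        then show ?thesis
          using M_closed[of "[pg_inv L (pg_inv L h), ?ch, pg_inv L h]"] \<open>?ch \<in> M\<close> h_inv M_inv[OF h_inv]
          by simp
      qed
    qed
    have w: "[g, pg_inv L f, f] \<in> pg_words L"
    proof (rule wordI[OF _ P])
      show "P \<subseteq> src [g, pg_inv L f, f]"
        using back_f f(2) less.prems(3) by (auto simp: source_def subset_iff)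
    qed (use less.prems fL in auto)
    have "pg_prod L [?c, f] = pg_prod L [g, pg_inv L f, f]" "[?c, f] \<in> pg_words L"
      using prod_assoc[of "[]" "[g, pg_inv L f]" "[f]"] w by auto
    moreover have "pg_prod L [g, pg_inv L f, f] = g"
      using cancel_inv_left(2)[of "[g]" f "[]"] w prod_singleton[OF less.prems(2)] by simp
    ultimately show ?case
      using M_closed[of "[?c, f]"] \<open>?c \<in> M\<close> f(1) by simp
  qed
  have "carrier L \<subseteq> M"
  proof
    fix g assume g: "g \<in> carrier L"
    then obtain P where "P \<in> \<Delta>" "P \<subseteq> src [g]" by (rule source_object)
    then show "g \<in> M" using all_in g by blast
  qed
  with M_sub show ?thesis by blast
qed

end

section \<open>The fusion system of a locality\<close>

lemma (in group) subset_set_mult: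
  assumes "subgroup A G" "subgroup B G"
  shows "A \<subseteq> A <#> B" "B \<subseteq> A <#> B"
proof -
  show "A \<subseteq> A <#> B"
  proof
    fix x assume "x \<in> A"
    then have "x = x \<otimes> \<one>" using subgroup.mem_carrier[OF assms(1)] by simp
    then show "x \<in> A <#> B"
      using \<open>x \<in> A\<close> subgroup.one_closed[OF assms(2)] unfolding set_mult_def by blast
  qed
  show "B \<subseteq> A <#> B"
  proof
    fix x assume "x \<in> B"
    then have "x = \<one> \<otimes> x" using subgroup.mem_carrier[OF assms(2)] by simp
    then show "x \<in> A <#> B"
      using \<open>x \<in> B\<close> subgroup.one_closed[OF assms(1)] unfolding set_mult_def by blast
  qed
qed

lemma fs_normalizer_hom_iff:
  "\<phi> \<in> fs_hom (fs_normalizer F P) A B \<longleftrightarrow> \<phi> \<in> fs_hom F A B \<and>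
    A \<subseteq> normalizer (fs_group F) P \<and> B \<subseteq> normalizer (fs_group F) P \<and>
    (\<exists>\<psi> \<in> fs_hom F (A <#>\<^bsub>fs_group F\<^esub> P) (B <#>\<^bsub>fs_group F\<^esub> P). (\<forall>x\<in>A. \<psi> x = \<phi> x) \<and> \<psi> ` P = P)"
  by (simp add: fs_normalizer_def Let_def)

lemma fs_centralizer_hom_iff:
  "\<phi> \<in> fs_hom (fs_centralizer F P) A B \<longleftrightarrow> \<phi> \<in> fs_hom F A B \<and>
    A \<subseteq> group_centralizer (fs_group F) P \<and> B \<subseteq> group_centralizer (fs_group F) P \<and>
    (\<exists>\<psi> \<in> fs_hom F (A <#>\<^bsub>fs_group F\<^esub> P) (B <#>\<^bsub>fs_group F\<^esub> P). (\<forall>x\<in>A. \<psi> x = \<phi> x) \<and> (\<forall>x\<in>P. \<psi> x = x))"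
  by (simp add: fs_centralizer_def Let_def)

context p_locality
begin

text \<open>
  The fusion system of the locality, described from the inside: its morphisms are the composites of
  conjugations along words that need not lie in the domain of the product.
\<close>

definition word_fusion :: "'a fusion_system" where
  "word_fusion = \<lparr>fs_group = S,
     fs_hom = (\<lambda>A B. {restrict (conj_along L w) A |w. subgroup A S \<and> subgroup B S \<and>
        set w \<subseteq> carrier L \<and> A \<subseteq> src w \<and> conj_along L w ` A \<subseteq> B})\<rparr>"

lemma word_fusion_group [simp]: "fs_group word_fusion = S"
  by (simp add: word_fusion_def)

lemma word_fusion_homI:
  "\<lbrakk>subgroup A S; subgroup B S; set w \<subseteq> carrier L; A \<subseteq> src w; conj_along L w ` A \<subseteq> B\<rbrakk> \<Longrightarrow>
    restrict (conj_along L w) A \<in> fs_hom word_fusion A B"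
  unfolding word_fusion_def by auto

lemma word_fusion_homE:
  assumes "\<phi> \<in> fs_hom word_fusion A B"
  obtains w where "subgroup A S" "subgroup B S" "set w \<subseteq> carrier L" "A \<subseteq> src w" "conj_along L w ` A \<subseteq> B"
    "\<phi> = restrict (conj_along L w) A"
  using assms unfolding word_fusion_def by auto

lemma conj_along_group_hom:
  assumes w: "set w \<subseteq> carrier L"
  shows "group_hom (S\<lparr>carrier := src w\<rparr>) S (conj_along L w)"
  unfolding group_hom_def group_hom_axioms_def
  using S.subgroup_imp_group[OF source_subgroup[OF w]] conj_along_mult[OF w] conj_along_in_target[of _ L "carrier S" w]
  by (auto simp: hom_def S.group_axioms)

lemma conj_along_subgroup:
  assumes "set w \<subseteq> carrier L" "subgroup A S" "A \<subseteq> src w"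
  shows "subgroup (conj_along L w ` A) S"
  using group_hom.subgroup_img_is_subgroup[OF conj_along_group_hom[OF assms(1)]]
    S.subgroup_incl[OF assms(2) source_subgroup[OF assms(1)] assms(3)] .

lemma fusion_system_word_fusion: "fusion_system S word_fusion"
proof (unfold_locales, goal_cases)
  case 1
  show ?case by simp
next
  case (2 \<phi> A B)
  then show ?case by (auto elim: word_fusion_homE)
next
  case (3 \<phi> A B)
  then obtain w where w: "subgroup A S" "subgroup B S" "set w \<subseteq> carrier L" "A \<subseteq> src w" "conj_along L w ` A \<subseteq> B"
    "\<phi> = restrict (conj_along L w) A" by (rule word_fusion_homE)
  have "conj_along L w (x \<otimes>\<^bsub>S\<^esub> y) = conj_along L w x \<otimes>\<^bsub>S\<^esub> conj_along L w y" "x \<otimes>\<^bsub>S\<^esub> y \<in> A"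
    if "x \<in> A" "y \<in> A" for x y
    using that conj_along_mult[OF w(3)] w(4) subgroup.m_closed[OF w(1)] by blast+
  moreover have "inj_on (conj_along L w) A"
    using inj_on_subset[OF inj_on_conj_along[OF w(3)] w(4)] .
  ultimately show ?case
    using w by (auto simp: hom_def inj_on_def)
next
  case (4 A B s)
  have "(\<lambda>x\<in>A. inv\<^bsub>S\<^esub> s \<otimes>\<^bsub>S\<^esub> x \<otimes>\<^bsub>S\<^esub> s) = restrict (conj_along L [s]) A"
    using S_conj(2)[OF _ 4(3)] subgroup.mem_carrier[OF 4(1)] by (intro restrict_ext) simp
  moreover have "restrict (conj_along L [s]) A \<in> fs_hom word_fusion A B"
  proof (rule word_fusion_homI[OF 4(1,2)])
    show "set [s] \<subseteq> carrier L" using 4(3) S_closed by auto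
    show "A \<subseteq> src [s]" using S_conj(1,3)[OF _ 4(3)] subgroup.mem_carrier[OF 4(1)] by (auto simp: source_single)
    show "conj_along L [s] ` A \<subseteq> B" using 4(4) S_conj(2)[OF _ 4(3)] subgroup.mem_carrier[OF 4(1)] by auto
  qed
  ultimately show ?case by simp
next
  case (5 \<phi> A B \<psi> C)
  from 5(1) obtain u where u: "subgroup A S" "subgroup B S" "set u \<subseteq> carrier L" "A \<subseteq> src u" "conj_along L u ` A \<subseteq> B"
    "\<phi> = restrict (conj_along L u) A" by (rule word_fusion_homE)
  from 5(2) obtain v where v: "subgroup C S" "set v \<subseteq> carrier L" "B \<subseteq> src v" "conj_along L v ` B \<subseteq> C"
    "\<psi> = restrict (conj_along L v) B" by (rule word_fusion_homE)
  have "compose A \<psi> \<phi> = restrict (conj_along L (u @ v)) A"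
    using u v by (auto simp: compose_def conj_along_append intro!: restrict_ext)
  moreover have "restrict (conj_along L (u @ v)) A \<in> fs_hom word_fusion A C"
  proof (rule word_fusion_homI[OF u(1) v(1)])
    have "x \<in> src u \<and> conj_along L u x \<in> src v \<and> conj_along L v (conj_along L u x) \<in> C" if "x \<in> A" for x
      using that u(4,5) v(3,4) by blast
    then show "A \<subseteq> src (u @ v)" "conj_along L (u @ v) ` A \<subseteq> C"
      by (auto simp: source_append conj_along_append)
  qed (use u v in auto)
  ultimately show ?case by simp
next
  case (6 \<phi> A B)
  then obtain w where w: "subgroup A S" "subgroup B S" "set w \<subseteq> carrier L" "A \<subseteq> src w" "conj_along L w ` A \<subseteq> B"
    "\<phi> = restrict (conj_along L w) A" by (rule word_fusion_homE)
  then have "\<phi> ` A = conj_along L w ` A" by simp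
  then show ?case
    using word_fusion_homI[OF w(1) conj_along_subgroup[OF w(3,1,4)] w(3,4)] w(6) by simp
next
  case (7 \<phi> A B)
  then obtain w where w: "subgroup A S" "subgroup B S" "set w \<subseteq> carrier L" "A \<subseteq> src w" "conj_along L w ` A \<subseteq> B"
    "\<phi> = restrict (conj_along L w) A" by (rule word_fusion_homE)
  have img: "\<phi> ` A = conj_along L w ` A" using w(6) by simp
  have returns: "conj_along L w x \<in> src (word_inv L w)" "conj_along L (word_inv L w) (conj_along L w x) = x" if "x \<in> A" for x
    using source_word_inv[OF w(3)] w(4) that by auto
  have "inj_on (conj_along L w) A"
    using inj_on_subset[OF inj_on_conj_along[OF w(3)] w(4)] .
  then have "inv_into A \<phi> (conj_along L w x) = x" if "x \<in> A" for x
    using that w(6) inv_into_f_f[of "restrict (conj_along L w) A" A x] by (simp add: inj_on_restrict_eq)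
  then have "restrict (inv_into A \<phi>) (\<phi> ` A) = restrict (conj_along L (word_inv L w)) (conj_along L w ` A)"
    unfolding img using returns(2) by (intro restrict_ext) auto
  moreover have "restrict (conj_along L (word_inv L w)) (conj_along L w ` A) \<in> fs_hom word_fusion (conj_along L w ` A) A"
    by (rule word_fusion_homI[OF conj_along_subgroup[OF w(3,1,4)] w(1) word_inv_closed[OF w(3)]])
      (use returns in auto)
  ultimately show ?case using img by simp
qed

text \<open>
  A composite of conjugations is decomposed letter by letter; the empty word gives an inclusion, which is
  conjugation by the unit of \<open>S\<close>.
\<close>

lemma word_fusion_least:
  assumes E: "fusion_system S E"
    and gen: "\<And>A B g. \<lbrakk>subgroup A S; subgroup B S; g \<in> carrier L; A \<subseteq> pg_conj_dom L g; pg_conj L g ` A \<subseteq> B\<rbrakk> \<Longrightarrow>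
      restrict (pg_conj L g) A \<in> fs_hom E A B"
  shows "fs_hom word_fusion A B \<subseteq> fs_hom E A B"
proof
  fix \<phi> assume "\<phi> \<in> fs_hom word_fusion A B"
  then obtain w where w: "subgroup A S" "subgroup B S" "set w \<subseteq> carrier L" "A \<subseteq> src w" "conj_along L w ` A \<subseteq> B"
    "\<phi> = restrict (conj_along L w) A" by (rule word_fusion_homE)
  have "restrict (conj_along L w) A \<in> fs_hom E A B"
    using w(1-5)
  proof (induction w arbitrary: A)
    case Nil
    have "x \<in> carrier S" if "x \<in> A" for x
      using subgroup.mem_carrier[OF Nil.prems(1) that] .
    then have id: "(\<lambda>x\<in>A. inv\<^bsub>S\<^esub> \<one>\<^bsub>S\<^esub> \<otimes>\<^bsub>S\<^esub> x \<otimes>\<^bsub>S\<^esub> \<one>\<^bsub>S\<^esub>) = restrict (conj_along L []) A"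
      "(\<lambda>x. inv\<^bsub>S\<^esub> \<one>\<^bsub>S\<^esub> \<otimes>\<^bsub>S\<^esub> x \<otimes>\<^bsub>S\<^esub> \<one>\<^bsub>S\<^esub>) ` A \<subseteq> B"
      using Nil.prems(5) by (auto intro!: restrict_ext)
    show ?case
      using fusion_system.fs_hom_conj[OF E Nil.prems(1,2) S.one_closed id(2)] unfolding id(1) .
  next
    case (Cons g w)
    have g: "g \<in> carrier L" "set w \<subseteq> carrier L" using Cons.prems(3) by auto
    have A: "A \<subseteq> src [g]" "pg_conj L g ` A \<subseteq> src w"
      using Cons.prems(4) by (auto simp: source_Cons[of L _ g w])
    have Ag: "subgroup (pg_conj L g ` A) S"
      using conj_along_subgroup[of "[g]" A] g A Cons.prems(1) by simp
    have dom: "A \<subseteq> pg_conj_dom L g"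
      by (rule subset_trans[OF A(1)]) (auto simp: source_single)
    have "restrict (pg_conj L g) A \<in> fs_hom E A (pg_conj L g ` A)"
      using gen[OF Cons.prems(1) Ag g(1)] dom by simp
    moreover have "conj_along L w ` pg_conj L g ` A \<subseteq> B"
      using Cons.prems(5) by (simp add: image_subset_iff)
    then have "restrict (conj_along L w) (pg_conj L g ` A) \<in> fs_hom E (pg_conj L g ` A) B"
      by (rule Cons.IH[OF Ag Cons.prems(2) g(2) A(2)])
    ultimately have "compose A (restrict (conj_along L w) (pg_conj L g ` A)) (restrict (pg_conj L g) A) \<in> fs_hom E A B"
      by (rule fusion_system.fs_hom_comp[OF E])
    moreover have "compose A (restrict (conj_along L w) (pg_conj L g ` A)) (restrict (pg_conj L g) A) =
        restrict (conj_along L (g # w)) A"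
      by (auto simp: compose_def intro!: restrict_ext)
    ultimately show ?case by (simp only:)
  qed
  then show "\<phi> \<in> fs_hom E A B" using w(6) by simp
qed

lemma locality_fusion_system_eq: "locality_fusion_system L S = word_fusion"
proof -
  let ?X = "\<lambda>A B. {restrict (pg_conj L g) A |g. subgroup A S \<and> subgroup B S \<and> g \<in> carrier L \<and>
        A \<subseteq> pg_conj_dom L g \<and> pg_conj L g ` A \<subseteq> B}"
  let ?hom = "\<lambda>A B. \<Inter>{fs_hom E A B |E. fusion_system S E \<and> (\<forall>A' B'. ?X A' B' \<subseteq> fs_hom E A' B')}"
  have X: "?X A B \<subseteq> fs_hom word_fusion A B" for A B
  proof
    fix \<phi> assume "\<phi> \<in> ?X A B"
    then obtain g where g: "subgroup A S" "subgroup B S" "g \<in> carrier L" "A \<subseteq> pg_conj_dom L g"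
      "pg_conj L g ` A \<subseteq> B" "\<phi> = restrict (pg_conj L g) A" by blast
    have "conj_along L [g] = pg_conj L g" by (rule ext) simp
    moreover have "A \<subseteq> src [g]"
      using g(4,5) subgroup.subset[OF g(1)] subgroup.subset[OF g(2)] unfolding source_single subset_iff
      by blast
    ultimately show "\<phi> \<in> fs_hom word_fusion A B"
      using word_fusion_homI[OF g(1,2), of "[g]"] g by simp
  qed
  have "?hom A B = fs_hom word_fusion A B" for A B
  proof (intro subset_antisym)
    show "?hom A B \<subseteq> fs_hom word_fusion A B"
      using fusion_system_word_fusion X by blast
    show "fs_hom word_fusion A B \<subseteq> ?hom A B"
    proof (rule Inter_greatest)
      fix Y assume "Y \<in> {fs_hom E A B |E. fusion_system S E \<and> (\<forall>A' B'. ?X A' B' \<subseteq> fs_hom E A' B')}"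
      then obtain E where E: "fusion_system S E" "\<And>A' B'. ?X A' B' \<subseteq> fs_hom E A' B'" "Y = fs_hom E A B"
        by blast
      show "fs_hom word_fusion A B \<subseteq> Y"
        unfolding E(3) by (rule word_fusion_least[OF E(1)]) (use E(2) in blast)
    qed
  qed
  then show ?thesis
    unfolding locality_fusion_system_def fs_generated_def by (simp add: word_fusion_def fun_eq_iff)
qed

text \<open>
  A word along which an object stays in \<open>S\<close> can be multiplied.
\<close>

lemma hom_on_object:
  assumes "\<phi> \<in> fs_hom word_fusion A B" "A \<in> \<Delta>"
  shows "\<exists>f\<in>carrier L. A \<subseteq> src [f] \<and> (\<forall>x\<in>A. \<phi> x = pg_conj L f x)"
proof -
  obtain w where w: "set w \<subseteq> carrier L" "A \<subseteq> src w" "\<phi> = restrict (conj_along L w) A"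
    using assms(1) by (rule word_fusion_homE)
  have "w \<in> pg_words L" using wordI[OF w(1) assms(2) w(2)] .
  then show ?thesis
    using source_prod[of w] w prod_closed[of w] by (intro bexI[of _ "pg_prod L w"]) auto
qed

lemma conj_hom:
  assumes "P \<in> \<Delta>" "g \<in> carrier L" "P \<subseteq> src [g]"
  shows "restrict (pg_conj L g) P \<in> fs_hom word_fusion P (pg_conj L g ` P)"
proof -
  have "conj_along L [g] = pg_conj L g" by (rule ext) simp
  then show ?thesis
    using word_fusion_homI[OF objects_subgroups[OF assms(1)], of "pg_conj L g ` P" "[g]"]
      conj_along_subgroup[of "[g]" P] objects_subgroups[OF assms(1)] assms by simp
qed

text \<open>
  The extension to \<open>P Q\<close> that normality or centrality of \<open>Q\<close> provides is conjugation by a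
  single element, because \<open>P Q\<close> is again an object.
\<close>

lemma realize_extension:
  assumes P: "P \<in> \<Delta>" and Q: "subgroup Q S" and \<psi>: "\<psi> \<in> fs_hom word_fusion (P <#>\<^bsub>S\<^esub> Q) B"
  shows "\<exists>f\<in>carrier L. P \<subseteq> src [f] \<and> Q \<subseteq> src [f] \<and> (\<forall>x\<in>P \<union> Q. \<psi> x = pg_conj L f x)"
proof -
  have PS: "subgroup P S" using objects_subgroups[OF P] .
  have sub: "subgroup (P <#>\<^bsub>S\<^esub> Q) S" using \<psi> by (rule word_fusion_homE)
  note PQ = S.subset_set_mult[OF PS Q]
  have "P <#>\<^bsub>S\<^esub> Q \<in> \<Delta>" using objects_overgroup[OF P sub] PQ by blast
  then show ?thesis
    using hom_on_object[OF \<psi>] PQ by blast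
qed

text \<open>
  Because \<open>src w\<close> is a subgroup of \<open>S\<close> on which conjugation along \<open>w\<close> is a homomorphism, a morphism
  extends from \<open>A\<close> to \<open>A Q\<close> as soon as \<open>Q\<close> stays in \<open>S\<close> along the same word.
\<close>

lemma extend_hom:
  assumes A: "subgroup A S" and B: "subgroup B S" and Q: "Q \<lhd> S"
    and w: "set w \<subseteq> carrier L" "A \<subseteq> src w" "conj_along L w ` A \<subseteq> B" "Q \<subseteq> src w" "conj_along L w ` Q = Q"
  shows "restrict (conj_along L w) (A <#>\<^bsub>S\<^esub> Q) \<in> fs_hom word_fusion (A <#>\<^bsub>S\<^esub> Q) (B <#>\<^bsub>S\<^esub> Q)"
    "x \<in> A \<Longrightarrow> x \<in> A <#>\<^bsub>S\<^esub> Q" "x \<in> Q \<Longrightarrow> x \<in> A <#>\<^bsub>S\<^esub> Q"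
proof -
  have QS: "subgroup Q S" using Q by (rule normal_imp_subgroup)
  have sub: "subgroup (C <#>\<^bsub>S\<^esub> Q) S" if "subgroup C S" for C
    using S.mult_norm_subgroup[OF Q that] S.commut_normal[OF that Q] by simp
  show "restrict (conj_along L w) (A <#>\<^bsub>S\<^esub> Q) \<in> fs_hom word_fusion (A <#>\<^bsub>S\<^esub> Q) (B <#>\<^bsub>S\<^esub> Q)"
  proof (rule word_fusion_homI[OF sub[OF A] sub[OF B] w(1)])
    show "A <#>\<^bsub>S\<^esub> Q \<subseteq> src w"
      using subgroup.m_closed[OF source_subgroup[OF w(1)]] w(2,4) by (auto simp: set_mult_def)
    show "conj_along L w ` (A <#>\<^bsub>S\<^esub> Q) \<subseteq> B <#>\<^bsub>S\<^esub> Q"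
    proof
      fix y assume "y \<in> conj_along L w ` (A <#>\<^bsub>S\<^esub> Q)"
      then obtain a q where aq: "a \<in> A" "q \<in> Q" "y = conj_along L w (a \<otimes>\<^bsub>S\<^esub> q)"
        by (auto simp: set_mult_def)
      then have "y = conj_along L w a \<otimes>\<^bsub>S\<^esub> conj_along L w q"
        using conj_along_mult[OF w(1)] w(2,4) by blast
      moreover have "conj_along L w a \<in> B" "conj_along L w q \<in> Q"
        using aq w(3,5) by blast+
      ultimately show "y \<in> B <#>\<^bsub>S\<^esub> Q" by (auto simp: set_mult_def)
    qed
  qed
  show "x \<in> A \<Longrightarrow> x \<in> A <#>\<^bsub>S\<^esub> Q" "x \<in> Q \<Longrightarrow> x \<in> A <#>\<^bsub>S\<^esub> Q"
    using S.subset_set_mult[OF A QS] by blast+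
qed

section \<open>Normal and central subgroups\<close>

lemma normalizer_of_normal:
  assumes "Q \<lhd> S"
  shows "normalizer S Q = carrier S"
proof -
  have Q: "Q \<subseteq> carrier S"
    using subgroup.subset[OF normal_imp_subgroup[OF assms]] .
  have "g <#\<^bsub>S\<^esub> Q #>\<^bsub>S\<^esub> inv\<^bsub>S\<^esub> g = Q" if "g \<in> carrier S" for g
    using normal.coset_eq[OF assms] S.coset_mult_assoc[OF Q that, of "inv\<^bsub>S\<^esub> g"] Q that by simp
  then show ?thesis
    using Q by (auto simp: normalizer_def stabilizer_def)
qed

theorem normal_in_word_fusion_iff:
  assumes ochar: "objective_characteristic p L \<Delta>" and Q: "subgroup Q S"
  shows "normal_in_fusion_system Q word_fusion \<longleftrightarrow> carrier L = pg_normalizer L Q"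
proof
  have QS: "Q \<subseteq> carrier S" using subgroup.subset[OF Q] .
  assume nf: "normal_in_fusion_system Q word_fusion"
  then have norm: "Q \<lhd> S" and eq: "fs_normalizer word_fusion Q = word_fusion"
    by (auto simp: normal_in_fusion_system_def)
  show "carrier L = pg_normalizer L Q"
  proof (rule partial_subgroup_realizing_fusion_is_everything[OF ochar normalizer_partial_subgroup[OF QS]])
    show "carrier S \<subseteq> pg_normalizer L Q"
    proof
      fix s assume s: "s \<in> carrier S"
      have into: "pg_conj L s ` Q \<subseteq> Q"
        using normal.inv_op_closed1[OF norm s] S_conj(2)[OF _ s] QS by auto
      have dom: "Q \<subseteq> pg_conj_dom L s" using S_conj(1)[OF _ s] QS by blast
      have sL: "s \<in> carrier L" using s S_closed by blast
      have "pg_conj L s ` Q = Q"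
        using into inj_on_conj[OF sL dom] finite_subset[OF QS finite_S] by (metis endo_inj_surj)
      then show "s \<in> pg_normalizer L Q" using dom sL by (simp add: pg_normalizer_def)
    qed
  next
    fix P g assume P: "P \<in> \<Delta>" and g: "g \<in> carrier L" "P \<subseteq> src [g]"
    have "restrict (pg_conj L g) P \<in> fs_hom (fs_normalizer word_fusion Q) P (pg_conj L g ` P)"
      unfolding eq using conj_hom[OF P g] .
    then obtain \<psi> where \<psi>: "\<psi> \<in> fs_hom word_fusion (P <#>\<^bsub>S\<^esub> Q) (pg_conj L g ` P <#>\<^bsub>S\<^esub> Q)"
      "\<forall>x\<in>P. \<psi> x = pg_conj L g x" "\<psi> ` Q = Q"
      unfolding fs_normalizer_hom_iff word_fusion_group by auto
    obtain f where f: "f \<in> carrier L" "P \<subseteq> src [f]" "Q \<subseteq> src [f]" "\<forall>x\<in>P \<union> Q. \<psi> x = pg_conj L f x"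
      using realize_extension[OF P Q \<psi>(1)] by blast
    have "pg_conj L f ` Q = \<psi> ` Q" using f(4) by (intro image_cong) auto
    then have "f \<in> pg_normalizer L Q"
      using normalizer_source_iff[OF QS] f \<psi>(3) by simp
    then show "\<exists>f\<in>pg_normalizer L Q. P \<subseteq> src [f] \<and> (\<forall>x\<in>P. pg_conj L f x = pg_conj L g x)"
      using f \<psi>(2) by (intro bexI[of _ f]) auto
  qed
next
  have QS: "Q \<subseteq> carrier S" using subgroup.subset[OF Q] .
  assume L: "carrier L = pg_normalizer L Q"
  have norm: "Q \<lhd> S"
    unfolding S.normal_inv_iff
  proof (intro conjI Q ballI)
    fix x h assume x: "x \<in> carrier S" and h: "h \<in> Q"
    have "inv\<^bsub>S\<^esub> x \<in> pg_normalizer L Q" using L S_closed x by auto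
    then have "pg_conj L (inv\<^bsub>S\<^esub> x) h \<in> Q" using h by (auto simp: pg_normalizer_def)
    then show "x \<otimes>\<^bsub>S\<^esub> h \<otimes>\<^bsub>S\<^esub> inv\<^bsub>S\<^esub> x \<in> Q"
      using S_conj(2)[of h "inv\<^bsub>S\<^esub> x"] x h QS by auto
  qed
  have "fs_hom (fs_normalizer word_fusion Q) A B = fs_hom word_fusion A B" for A B
  proof
    show "fs_hom (fs_normalizer word_fusion Q) A B \<subseteq> fs_hom word_fusion A B"
      by (auto simp: fs_normalizer_hom_iff)
    show "fs_hom word_fusion A B \<subseteq> fs_hom (fs_normalizer word_fusion Q) A B"
    proof
      fix \<phi> assume \<phi>: "\<phi> \<in> fs_hom word_fusion A B"
      then obtain w where w: "subgroup A S" "subgroup B S" "set w \<subseteq> carrier L" "A \<subseteq> src w" "conj_along L w ` A \<subseteq> B"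
        "\<phi> = restrict (conj_along L w) A" by (rule word_fusion_homE)
      note rQ = conj_along_normalizing[OF QS w(3)[unfolded L]]
      note ext = extend_hom[OF w(1,2) norm w(3-5) rQ]
      have "\<forall>x\<in>A. restrict (conj_along L w) (A <#>\<^bsub>S\<^esub> Q) x = \<phi> x"
        using ext(2) w(6) by simp
      moreover have "restrict (conj_along L w) (A <#>\<^bsub>S\<^esub> Q) ` Q = Q"
        using ext(3) image_cong[OF refl, of Q "restrict (conj_along L w) (A <#>\<^bsub>S\<^esub> Q)" "conj_along L w"] rQ(2) by simp
      ultimately show "\<phi> \<in> fs_hom (fs_normalizer word_fusion Q) A B"
        unfolding fs_normalizer_hom_iff word_fusion_group normalizer_of_normal[OF norm]
        using \<phi> ext(1) subgroup.subset[OF w(1)] subgroup.subset[OF w(2)] by blast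
    qed
  qed
  then have "fs_hom (fs_normalizer word_fusion Q) = fs_hom word_fusion" by blast
  moreover have "fs_group (fs_normalizer word_fusion Q) = fs_group word_fusion"
    using normalizer_of_normal[OF norm] by (simp add: fs_normalizer_def Let_def)
  ultimately show "normal_in_fusion_system Q word_fusion"
    using norm by (simp add: normal_in_fusion_system_def)
qed

theorem centralizer_word_fusion_iff:
  assumes ochar: "objective_characteristic p L \<Delta>" and Q: "subgroup Q S"
  shows "fs_centralizer word_fusion Q = word_fusion \<longleftrightarrow> carrier L = pg_centralizer L Q"
proof
  have QS: "Q \<subseteq> carrier S" using subgroup.subset[OF Q] .
  assume eq: "fs_centralizer word_fusion Q = word_fusion"
  have "fs_group (fs_centralizer word_fusion Q) = S" using eq by simp
  then have "carrier (S\<lparr>carrier := group_centralizer S Q\<rparr>) = carrier S"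
    by (simp add: fs_centralizer_def Let_def)
  then have CS: "group_centralizer S Q = carrier S" by simp
  show "carrier L = pg_centralizer L Q"
  proof (rule partial_subgroup_realizing_fusion_is_everything[OF ochar centralizer_partial_subgroup[OF QS]])
    show "carrier S \<subseteq> pg_centralizer L Q"
    proof
      fix s assume s: "s \<in> carrier S"
      have "x \<in> pg_conj_dom L s \<and> pg_conj L s x = x" if "x \<in> Q" for x
      proof -
        have x: "x \<in> carrier S" using that QS by blast
        have "s \<otimes>\<^bsub>S\<^esub> x = x \<otimes>\<^bsub>S\<^esub> s"
          using s that unfolding CS[symmetric] by (simp add: group_centralizer_def)
        then have "inv\<^bsub>S\<^esub> s \<otimes>\<^bsub>S\<^esub> x \<otimes>\<^bsub>S\<^esub> s = x"
          using s x by (simp add: S.m_assoc S.inv_solve_left')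
        then show ?thesis using S_conj(1,2)[OF x s] by simp
      qed
      then show "s \<in> pg_centralizer L Q" using s S_closed by (auto simp: pg_centralizer_def)
    qed
  next
    fix P g assume P: "P \<in> \<Delta>" and g: "g \<in> carrier L" "P \<subseteq> src [g]"
    have "restrict (pg_conj L g) P \<in> fs_hom (fs_centralizer word_fusion Q) P (pg_conj L g ` P)"
      unfolding eq using conj_hom[OF P g] .
    then obtain \<psi> where \<psi>: "\<psi> \<in> fs_hom word_fusion (P <#>\<^bsub>S\<^esub> Q) (pg_conj L g ` P <#>\<^bsub>S\<^esub> Q)"
      "\<forall>x\<in>P. \<psi> x = pg_conj L g x" "\<forall>x\<in>Q. \<psi> x = x"
      unfolding fs_centralizer_hom_iff word_fusion_group by auto
    obtain f where f: "f \<in> carrier L" "P \<subseteq> src [f]" "Q \<subseteq> src [f]" "\<forall>x\<in>P \<union> Q. \<psi> x = pg_conj L f x"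
      using realize_extension[OF P Q \<psi>(1)] by blast
    then have "f \<in> pg_centralizer L Q"
      using centralizer_source_iff[OF QS] \<psi>(3) by simp
    then show "\<exists>f\<in>pg_centralizer L Q. P \<subseteq> src [f] \<and> (\<forall>x\<in>P. pg_conj L f x = pg_conj L g x)"
      using f \<psi>(2) by (intro bexI[of _ f]) auto
  qed
next
  have QS: "Q \<subseteq> carrier S" using subgroup.subset[OF Q] .
  assume L: "carrier L = pg_centralizer L Q"
  have comm: "s \<otimes>\<^bsub>S\<^esub> x = x \<otimes>\<^bsub>S\<^esub> s" if s: "s \<in> carrier S" and x: "x \<in> Q" for s x
  proof -
    have "s \<in> pg_centralizer L Q" using L S_closed s by blast
    then have "pg_conj L s x = x" using x by (simp add: pg_centralizer_def)
    then have "inv\<^bsub>S\<^esub> s \<otimes>\<^bsub>S\<^esub> x \<otimes>\<^bsub>S\<^esub> s = x"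
      using S_conj(2)[OF _ s, of x] x QS by auto
    then have "s \<otimes>\<^bsub>S\<^esub> x = s \<otimes>\<^bsub>S\<^esub> (inv\<^bsub>S\<^esub> s \<otimes>\<^bsub>S\<^esub> (x \<otimes>\<^bsub>S\<^esub> s))"
      using s x QS by (simp add: S.m_assoc subset_iff)
    then show ?thesis
      using s x QS by (simp add: S.m_assoc[symmetric] subset_iff)
  qed
  have CS: "group_centralizer S Q = carrier S"
    using comm by (auto simp: group_centralizer_def)
  have norm: "Q \<lhd> S"
    unfolding S.normal_inv_iff
  proof (intro conjI Q ballI)
    fix x h assume x: "x \<in> carrier S" and h: "h \<in> Q"
    then show "x \<otimes>\<^bsub>S\<^esub> h \<otimes>\<^bsub>S\<^esub> inv\<^bsub>S\<^esub> x \<in> Q"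
      using comm[OF x h] QS by (simp add: S.m_assoc subset_iff)
  qed
  have "fs_hom (fs_centralizer word_fusion Q) A B = fs_hom word_fusion A B" for A B
  proof
    show "fs_hom (fs_centralizer word_fusion Q) A B \<subseteq> fs_hom word_fusion A B"
      by (auto simp: fs_centralizer_hom_iff)
    show "fs_hom word_fusion A B \<subseteq> fs_hom (fs_centralizer word_fusion Q) A B"
    proof
      fix \<phi> assume \<phi>: "\<phi> \<in> fs_hom word_fusion A B"
      then obtain w where w: "subgroup A S" "subgroup B S" "set w \<subseteq> carrier L" "A \<subseteq> src w" "conj_along L w ` A \<subseteq> B"
        "\<phi> = restrict (conj_along L w) A" by (rule word_fusion_homE)
      note rQ = conj_along_centralizing[OF QS w(3)[unfolded L]]
      have "Q \<subseteq> src w" "conj_along L w ` Q = Q" using rQ by auto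
      note ext = extend_hom[OF w(1,2) norm w(3-5) this]
      have "\<forall>x\<in>A. restrict (conj_along L w) (A <#>\<^bsub>S\<^esub> Q) x = \<phi> x"
        using ext(2) w(6) by simp
      moreover have "\<forall>x\<in>Q. restrict (conj_along L w) (A <#>\<^bsub>S\<^esub> Q) x = x"
        using ext(3) rQ(2) by simp
      ultimately show "\<phi> \<in> fs_hom (fs_centralizer word_fusion Q) A B"
        unfolding fs_centralizer_hom_iff word_fusion_group CS
        using \<phi> ext(1) subgroup.subset[OF w(1)] subgroup.subset[OF w(2)] by blast
    qed
  qed
  then have "fs_hom (fs_centralizer word_fusion Q) = fs_hom word_fusion" by blast
  moreover have "fs_group (fs_centralizer word_fusion Q) = fs_group word_fusion"
    using CS by (simp add: fs_centralizer_def Let_def)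
  ultimately show "fs_centralizer word_fusion Q = word_fusion" by simp
qed

text \<open>
  This subgroup of \<open>S\<close> turns out to be the centre of the fusion system. It provides the greatest
  element that the definition of the centre asks for.
\<close>

definition fixed_points :: "'a set" where
  "fixed_points = {x \<in> carrier S. \<forall>g\<in>carrier L. x \<in> pg_conj_dom L g \<and> pg_conj L g x = x}"

lemma fixed_points_iff:
  assumes "Q \<subseteq> carrier S"
  shows "carrier L = pg_centralizer L Q \<longleftrightarrow> Q \<subseteq> fixed_points"
  using assms unfolding fixed_points_def pg_centralizer_def by blast

lemma fixed_points_subgroup: "subgroup fixed_points S"
proof (rule S.subgroupI)
  have src: "x \<in> src [g] \<and> pg_conj L g x = x" if "x \<in> fixed_points" "g \<in> carrier L" for x g
    using that by (auto simp: fixed_points_def source_single)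
  have fixI: "x \<in> fixed_points"
    if "x \<in> carrier S" "\<And>g. g \<in> carrier L \<Longrightarrow> x \<in> src [g] \<and> pg_conj L g x = x" for x
    using that by (auto simp: fixed_points_def source_single)
  have hom: "group_hom (S\<lparr>carrier := src [g]\<rparr>) S (pg_conj L g)" if "g \<in> carrier L" for g
  proof -
    have "conj_along L [g] = pg_conj L g" by (rule ext) simp
    then show ?thesis using conj_along_group_hom[of "[g]"] that by simp
  qed
  show sub: "fixed_points \<subseteq> carrier S" by (auto simp: fixed_points_def)
  have "\<one>\<^bsub>S\<^esub> \<in> fixed_points"
    using group_hom.hom_one[OF hom] subgroup.one_closed[OF source_single_subgroup] by (intro fixI) auto
  then show "fixed_points \<noteq> {}" by blast
  show "inv\<^bsub>S\<^esub> x \<in> fixed_points" if x: "x \<in> fixed_points" for x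
  proof (rule fixI)
    show "inv\<^bsub>S\<^esub> x \<in> carrier S" using x sub by blast
    fix g assume g: "g \<in> carrier L"
    note sg = source_single_subgroup[OF g]
    have "pg_conj L g (inv\<^bsub>S\<lparr>carrier := src [g]\<rparr>\<^esub> x) = inv\<^bsub>S\<^esub> (pg_conj L g x)"
      using group_hom.hom_inv[OF hom[OF g]] src[OF x g] by simp
    then show "inv\<^bsub>S\<^esub> x \<in> src [g] \<and> pg_conj L g (inv\<^bsub>S\<^esub> x) = inv\<^bsub>S\<^esub> x"
      using S.m_inv_consistent[OF sg] src[OF x g] subgroup.m_inv_closed[OF sg] by simp
  qed
  show "x \<otimes>\<^bsub>S\<^esub> y \<in> fixed_points" if "x \<in> fixed_points" "y \<in> fixed_points" for x y
    using that sub src source_mult by (intro fixI) auto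
qed

lemma fs_center_word_fusion:
  assumes "objective_characteristic p L \<Delta>"
  shows "fs_center word_fusion = fixed_points"
proof -
  have iff: "subgroup Z (fs_group word_fusion) \<and> fs_centralizer word_fusion Z = word_fusion \<longleftrightarrow>
      subgroup Z S \<and> Z \<subseteq> fixed_points" for Z
    using centralizer_word_fusion_iff[OF assms, of Z] fixed_points_iff[OF subgroup.subset, of Z] by auto
  show ?thesis
    unfolding fs_center_def iff
    by (rule Greatest_equality) (use fixed_points_subgroup in auto)
qed

end

theorem proposition5:
  fixes p :: nat and S :: "'a monoid" and F :: "'a fusion_system"
    and L :: "'a partial_group" and \<Delta> :: "'a set set" and Q :: "'a set"
  assumes "prime p"
    and "finite_p_group p S"
    and "fusion_system S F"
    and "locality_over F p L \<Delta> S"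
    and "objective_characteristic p L \<Delta>"
    and "subgroup Q S"
  shows "(normal_in_fusion_system Q F \<longleftrightarrow> carrier L = pg_normalizer L Q) \<and>
         (Q \<subseteq> fs_center F \<longleftrightarrow> carrier L = pg_centralizer L Q)"
proof -
  have "locality p L \<Delta> S" and F: "F = locality_fusion_system L S"
    using assms(4) by (auto simp: locality_over_def)
  moreover have "group S"
    using assms(2) by (simp add: finite_p_group_def)
  ultimately interpret p_locality p L \<Delta> S
    using assms(1) by (simp add: p_locality_def p_locality_axioms_def)
  have "F = word_fusion"
    using F locality_fusion_system_eq by simp
  then show ?thesis
    using normal_in_word_fusion_iff[OF assms(5,6)] fs_center_word_fusion[OF assms(5)]
      fixed_points_iff[OF subgroup.subset[OF assms(6)]]
    by simp
qed

end
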